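(* Let $d,k,m,B$ be positive integers, $L>0$, and let $\mathcal{A}$ be a distribution on complex $mB\times d$ matrices such that $$\mathbb{E}_{A\sim\mathcal{A}}\sup_{x\in T_k}\left|\frac{1}{mB}\|Ax\|_2^2-\|x\|_2^2\right|\lesssim\sqrt{\frac{L}{mB}}.$$ Let $\Phi$ be obtained from the construction in the context. Then $$\mathbb{E}\sup_{x\in T_k}\left|\frac{1}{mB}\|\Phi x\|_2^2-\|x\|_2^2\right|\lesssim\frac{1}{mB}\left(\mathbb{E}_A\Big[\sup_{x\in T_k}\|Ax\|_2\,\gamma_2(T_k,\|\cdot\|_X)\Big]+\mathbb{E}_A\,\gamma_2^2(T_k,\|\cdot\|_X)\right)+\sqrt{\frac{L}{mB}},$$ where the expectation on the left is over both $A$ and the signs, and $\|x\|_X:=\max_{b\in[m]}\|A_bx\|_2$.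
   Context: Construction: draw $A\sim\mathcal{A}$ with rows $a_1,\dots,a_{mB}$; for $(b,i)\in[m]\times[B]$ let $h(b,i)=B(b-1)+i$, and let $A_b$ be the $B\times d$ matrix with rows $a_{h(b,1)},\dots,a_{h(b,B)}$; draw independent uniform signs $\sigma_{b,i}\in\{\pm1\}$ independent of $A$; $\Phi\in\mathbb{C}^{m\times d}$ has $b$-th row $\sum_{i\in[B]}\sigma_{b,i}a_{h(b,i)}$. $T_k=\{x\in\mathbb{C}^d:\ x\text{ has at most }k\text{ nonzero entries},\ \|x\|_2\le1\}$. Talagrand's functional: for a set $T$ with (pseudo)metric $\rho$, an admissible sequence is a sequence of subsets $A_1,A_2,\dots$ of $T$ with $|A_n|\le2^{2^n}$, and $\gamma_2(T,\rho)=\inf\sup_{t\in T}\sum_{n\ge1}2^{n/2}\rho(A_n,t)$, the infimum over admissible sequences, where $\rho(A_n,t)=\inf_{a\in A_n}\rho(a,t)$; $\gamma_2(T_k,\|\cdot\|_X)$ uses $\rho(x,y)=\|x-y\|_X$. $f\lesssim g$ means $f\le Cg$ for an absolute constant $C$. *)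

theory Defs
  imports "HOL-Probability.Probability" "Jordan_Normal_Form.Matrix"
begin

unbundle no vec_syntax

definition vnorm :: "complex vec \<Rightarrow> real" where
  "vnorm x = L2_set (\<lambda>i. cmod (x $ i)) {..<dim_vec x}"

definition sparse_ball :: "nat \<Rightarrow> nat \<Rightarrow> complex vec set" where
  "sparse_ball d k =
     {x \<in> carrier_vec d. card {j. j < d \<and> x $ j \<noteq> 0} \<le> k \<and> vnorm x \<le> 1}"

text \<open>Members of an admissible sequence may be empty. This is harmless, since the distance to the
  empty set is infinite. Only the members with index at least 1 matter.\<close>

definition admissible_seq :: "'a set \<Rightarrow> (nat \<Rightarrow> 'a set) \<Rightarrow> bool" where
  "admissible_seq T S \<longleftrightarrow>
     (\<forall>n\<ge>1. S n \<subseteq> T \<and> finite (S n) \<and> card (S n) \<le> 2 ^ (2 ^ n))"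

definition set_dist :: "('a \<Rightarrow> 'a \<Rightarrow> real) \<Rightarrow> 'a set \<Rightarrow> 'a \<Rightarrow> ennreal" where
  "set_dist \<rho> S t = (INF a\<in>S. ennreal (\<rho> a t))"

text \<open>The series starts at level 1, hence the shift by \<^const>\<open>Suc\<close>.\<close>

definition gamma2 :: "'a set \<Rightarrow> ('a \<Rightarrow> 'a \<Rightarrow> real) \<Rightarrow> ennreal" where
  "gamma2 T \<rho> =
     (INF S\<in>{S. admissible_seq T S}. SUP t\<in>T.
        (\<Sum>n. ennreal (2 powr (real (Suc n) / 2)) * set_dist \<rho> (S (Suc n)) t))"

text \<open>The Borel \<open>\<sigma>\<close>-algebra on complex matrices of a fixed size, that is, the
  \<open>\<sigma>\<close>-algebra generated by the entries. The measure itself is irrelevant.\<close>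

definition mat_borel :: "nat \<Rightarrow> nat \<Rightarrow> complex mat measure" where
  "mat_borel nr nc =
     vimage_algebra (carrier_mat nr nc)
       (\<lambda>A. \<lambda>p\<in>{..<nr} \<times> {..<nc}. A $$ p)
       (PiM ({..<nr} \<times> {..<nc}) (\<lambda>_. borel))"

definition mat_distribution :: "nat \<Rightarrow> nat \<Rightarrow> complex mat measure \<Rightarrow> bool" where
  "mat_distribution nr nc \<A> \<longleftrightarrow> prob_space \<A> \<and> sets \<A> = sets (mat_borel nr nc)"

text \<open>Rows and blocks are numbered from 0, so the \<open>i\<close>-th row of block \<open>b\<close> is the row
  \<open>B * b + i\<close> of the whole matrix.\<close>

definition row_block :: "nat \<Rightarrow> complex mat \<Rightarrow> nat \<Rightarrow> complex mat" where
  "row_block B A b = mat B (dim_col A) (\<lambda>(i, j). A $$ (B * b + i, j))"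

definition block_norm :: "nat \<Rightarrow> nat \<Rightarrow> complex mat \<Rightarrow> complex vec \<Rightarrow> real" where
  "block_norm m B A x = Max ((\<lambda>b. vnorm (row_block B A b *\<^sub>v x)) ` {..<m})"

text \<open>Independent uniform signs indexed by \<open>{..<m} \<times> {..<B}\<close>; the value 1 outside
  this index set is a dummy.\<close>

definition sign_pmf :: "nat \<Rightarrow> nat \<Rightarrow> (nat \<times> nat \<Rightarrow> real) pmf" where
  "sign_pmf m B = Pi_pmf ({..<m} \<times> {..<B}) 1 (\<lambda>_. pmf_of_set {-1, 1})"

definition signed_block_sum ::
    "nat \<Rightarrow> nat \<Rightarrow> complex mat \<Rightarrow> (nat \<times> nat \<Rightarrow> real) \<Rightarrow> complex mat" where
  "signed_block_sum m B A \<sigma> =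
     mat m (dim_col A) (\<lambda>(b, j). \<Sum>i<B. complex_of_real (\<sigma> (b, i)) * A $$ (B * b + i, j))"

text \<open>The scaling is by the parameter \<open>N\<close>, which need not be the number of rows of \<open>M\<close>.\<close>

definition isometry_defect :: "nat \<Rightarrow> nat \<Rightarrow> nat \<Rightarrow> complex mat \<Rightarrow> ennreal" where
  "isometry_defect d k N M =
     (SUP x\<in>sparse_ball d k. ennreal \<bar>1 / real N * (vnorm (M *\<^sub>v x))\<^sup>2 - (vnorm x)\<^sup>2\<bar>)"

end

theory Submission
  imports Defs
begin

text \<open>
  Condition on \<open>A\<close> and write \<open>N x \<sigma>\<close> for \<open>\<parallel>\<Phi> x\<parallel>\<^sup>2\<close>. Since \<open>\<tau> * \<sigma>\<close> is again a uniform
  sign pattern, the centred process \<open>N x \<sigma> - \<parallel>A x\<parallel>\<^sup>2\<close> is the average over \<open>\<tau>\<close> of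
  \<open>N x \<sigma> - N x (\<tau> * \<sigma>)\<close>, which is 4 times the real inner product of the contributions of the signs
  in \<open>I = {\<tau> = 1}\<close> and of those outside \<open>I\<close>. For fixed \<open>\<tau>\<close> this decouples the chaos: each
  increment splits into two terms, and each of them is subgaussian conditionally on one half of the
  signs, with scale \<open>\<parallel>x - y\<parallel>\<^sub>X\<close> times the norm of the other half's contribution. Chaining along an
  almost optimal admissible sequence bounds the supremum by \<open>\<gamma>\<^sub>2 * U * Y\<close>, where \<open>U\<close> has bounded
  second moment and \<open>Y\<^sup>2\<close> is at most \<open>sup \<parallel>A x\<parallel>\<^sup>2\<close> plus the supremum of the centred process itself.
  A weighted arithmetic-geometric mean inequality absorbs the latter.
\<close>

subsection \<open>Averages over sign patterns\<close>

text \<open>The norm of the other half's contribution is a random supremum of the same kind as the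
  one being estimated. Its worst-case bound would cost a factor \<open>sqrt B\<close>, so the
  estimate is closed on itself instead. This is legitimate because that crude bound makes the
  supremum finite for each of the finitely many sign patterns. Two features of the target shape the
  rest. The series in \<open>gamma2\<close> starts at level 1 and has no explicit diameter term, so
  a chain that starts at the zero vector, where the process vanishes, needs its first link bounded
  separately. And no measurability of \<open>gamma2\<close> in the matrix is established: its
  integrals over \<open>A\<close> are lower integrals, for which subadditivity and equality in
  Fubini may fail. Hence the estimate is proved for each single matrix and then integrated through
  measurable minorants.\<close>

definition avg :: "'a set \<Rightarrow> ('a \<Rightarrow> real) \<Rightarrow> real" where
  "avg S f = (\<Sum>s\<in>S. f s) / real (card S)"

lemma avg_mono: "(\<And>s. s \<in> S \<Longrightarrow> f s \<le> g s) \<Longrightarrow> avg S f \<le> avg S g"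
  unfolding avg_def by (intro divide_right_mono sum_mono) auto

lemma avg_cong: "(\<And>s. s \<in> S \<Longrightarrow> f s = g s) \<Longrightarrow> avg S f = avg S g"
  unfolding avg_def by simp

lemma avg_add: "avg S (\<lambda>s. f s + g s) = avg S f + avg S g"
  unfolding avg_def by (simp add: sum.distrib add_divide_distrib)

lemma avg_cmult: "avg S (\<lambda>s. c * f s) = c * avg S f"
  unfolding avg_def by (simp add: sum_distrib_left)

lemma avg_sum: "avg S (\<lambda>s. \<Sum>i\<in>I. f i s) = (\<Sum>i\<in>I. avg S (f i))"
  unfolding avg_def by (subst sum.swap) (simp add: sum_divide_distrib)

lemma avg_const: "finite S \<Longrightarrow> S \<noteq> {} \<Longrightarrow> avg S (\<lambda>_. c) = c"
  unfolding avg_def by simp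

lemma avg_swap: "avg S (\<lambda>s. avg T (\<lambda>t. f s t)) = avg T (\<lambda>t. avg S (\<lambda>s. f s t))"
  unfolding avg_def by (simp add: sum_divide_distrib[symmetric]) (subst sum.swap, simp add: mult.commute)

lemma abs_avg_le: "\<bar>avg S f\<bar> \<le> avg S (\<lambda>s. \<bar>f s\<bar>)"
  unfolding avg_def by (auto simp: abs_divide intro!: divide_right_mono)

text \<open>The default value 1 agrees with \<open>sign_pmf\<close> and keeps every coordinate equal
  to 1 or -1, inside \<open>J\<close> or not, so patterns are closed under pointwise products and
  square to 1 everywhere.\<close>

definition signs :: "'j set \<Rightarrow> ('j \<Rightarrow> real) set" where
  "signs J = PiE_dflt J 1 (\<lambda>_. {-1, 1})"

lemma signsD: "\<sigma> \<in> signs J \<Longrightarrow> \<sigma> j = 1 \<or> \<sigma> j = -1"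
  unfolding signs_def PiE_dflt_def by auto

lemma finite_signs: "finite J \<Longrightarrow> finite (signs J)"
  unfolding signs_def by (rule finite_PiE_dflt) auto

lemma signs_nonempty: "signs J \<noteq> {}"
  unfolding signs_def by simp

lemma signs_flip: "\<sigma> \<in> signs J \<Longrightarrow> j \<in> J \<Longrightarrow> \<sigma>(j := - \<sigma> j) \<in> signs J"
  unfolding signs_def PiE_dflt_def by auto

lemma signs_mult: "\<sigma> \<in> signs J \<Longrightarrow> \<tau> \<in> signs J \<Longrightarrow> (\<lambda>j. \<tau> j * \<sigma> j) \<in> signs J"
  unfolding signs_def PiE_dflt_def by auto force+

lemma signs_square: "\<sigma> \<in> signs J \<Longrightarrow> \<sigma> j * \<sigma> j = 1"
  using signsD[of \<sigma> J j] by auto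

lemma sum_signs_flip:
  assumes "j \<in> J"
  shows "(\<Sum>\<sigma>\<in>signs J. f (\<sigma>(j := - \<sigma> j))) = (\<Sum>\<sigma>\<in>signs J. f \<sigma>)"
  by (rule sum.reindex_bij_witness[where i="\<lambda>\<sigma>. \<sigma>(j := - \<sigma> j)" and j="\<lambda>\<sigma>. \<sigma>(j := - \<sigma> j)"])
     (auto simp: signs_flip assms)

lemma avg_signs_mult:
  assumes "\<tau> \<in> signs J"
  shows "avg (signs J) (\<lambda>\<sigma>. f (\<lambda>j. \<tau> j * \<sigma> j)) = avg (signs J) f"
proof -
  have "(\<lambda>j. \<tau> j * (\<tau> j * \<sigma> j)) = \<sigma>" for \<sigma> :: "'a \<Rightarrow> real"
    using signs_square[OF assms] by (auto simp: mult.assoc[symmetric])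
  then have "(\<Sum>\<sigma>\<in>signs J. f (\<lambda>j. \<tau> j * \<sigma> j)) = (\<Sum>\<sigma>\<in>signs J. f \<sigma>)"
    by (intro sum.reindex_bij_witness[where i="\<lambda>\<sigma> j. \<tau> j * \<sigma> j" and j="\<lambda>\<sigma> j. \<tau> j * \<sigma> j"])
       (auto simp: assms signs_mult)
  then show ?thesis
    unfolding avg_def by simp
qed

lemma avg_signs_mult_right:
  assumes "\<sigma> \<in> signs J"
  shows "avg (signs J) (\<lambda>\<tau>. f (\<lambda>j. \<tau> j * \<sigma> j)) = avg (signs J) f"
  using avg_signs_mult[OF assms, of f] by (simp add: mult.commute)

lemma avg_signs_product:
  assumes "finite J" "i \<in> J"
  shows "avg (signs J) (\<lambda>\<sigma>. \<sigma> i * \<sigma> j) = (if i = j then 1 else 0)"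
proof (cases "i = j")
  case True
  have "avg (signs J) (\<lambda>\<sigma>. \<sigma> i * \<sigma> j) = avg (signs J) (\<lambda>_. 1)"
    using True by (intro avg_cong) (simp add: signs_square)
  then show ?thesis
    using True by (simp add: avg_const finite_signs signs_nonempty assms)
next
  case False
  have "(\<Sum>\<sigma>\<in>signs J. \<sigma> i * \<sigma> j) = (\<Sum>\<sigma>\<in>signs J. - (\<sigma> i * \<sigma> j))"
    using sum_signs_flip[OF assms(2), of "\<lambda>\<sigma>. \<sigma> i * \<sigma> j"] False by simp
  then have "(\<Sum>\<sigma>\<in>signs J. \<sigma> i * \<sigma> j) = 0"
    by (simp add: sum_negf)
  then show ?thesis
    using False by (simp add: avg_def)
qed

section \<open>Moment generating functions of Rademacher sums\<close>

lemma tanh_le_real: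
  fixes x :: real
  assumes "x \<ge> 0"
  shows "tanh x \<le> x"
proof -
  have "(\<lambda>x. x - tanh x) 0 \<le> (\<lambda>x. x - tanh x) x"
  proof (rule DERIV_nonneg_imp_nondecreasing[OF assms])
    fix y :: real
    have "((\<lambda>x. x - tanh x) has_real_derivative (tanh y)\<^sup>2) (at y)"
      by (auto intro!: derivative_eq_intros)
    then show "\<exists>l. ((\<lambda>x. x - tanh x) has_real_derivative l) (at y) \<and> 0 \<le> l"
      by (meson zero_le_power2)
  qed
  then show ?thesis
    by simp
qed

lemma cosh_le_exp_square: "cosh (x::real) \<le> exp (x\<^sup>2 / 2)"
proof -
  have *: "cosh x \<le> exp (x\<^sup>2 / 2)" if "x \<ge> 0" for x :: real
  proof -
    have "(\<lambda>x. x\<^sup>2 / 2 - ln (cosh x)) 0 \<le> (\<lambda>x. x\<^sup>2 / 2 - ln (cosh x)) x"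
    proof (rule DERIV_nonneg_imp_nondecreasing[OF that])
      fix y :: real assume "0 \<le> y"
      have "((\<lambda>x. x\<^sup>2 / 2 - ln (cosh x)) has_real_derivative y - tanh y) (at y)"
        by (auto intro!: derivative_eq_intros simp: tanh_def cosh_real_pos field_simps)
      then show "\<exists>l. ((\<lambda>x. x\<^sup>2 / 2 - ln (cosh x)) has_real_derivative l) (at y) \<and> 0 \<le> l"
        using tanh_le_real[OF \<open>0 \<le> y\<close>] by (intro exI[of _ "y - tanh y"]) simp
    qed
    then show ?thesis
      by (simp add: ln_le_cancel_iff[symmetric] cosh_real_pos flip: ln_ge_iff)
  qed
  show ?thesis
    using *[of x] *[of "-x"] by (cases "x \<ge> 0") auto
qed

text \<open>Conditioning without splitting the space: the coefficients may depend on the signs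
  outside \<open>I\<close>, and only their invariance under flips inside \<open>I\<close> is
  recorded. The weight \<open>h\<close> is general so that a factor
  \<open>exp ((c j \<sigma>)\<^sup>2 / 2)\<close> already gained can be moved into it before the
  induction hypothesis is applied.\<close>

lemma sum_signs_exp_le:
  fixes c :: "'j \<Rightarrow> ('j \<Rightarrow> real) \<Rightarrow> real"
  assumes "finite I" "I \<subseteq> J"
    and "\<And>\<sigma>. \<sigma> \<in> signs J \<Longrightarrow> 0 \<le> h \<sigma>"
    and "\<And>\<sigma> j. \<sigma> \<in> signs J \<Longrightarrow> j \<in> I \<Longrightarrow> h (\<sigma>(j := - \<sigma> j)) = h \<sigma>"
    and "\<And>\<sigma> i j. \<sigma> \<in> signs J \<Longrightarrow> j \<in> I \<Longrightarrow> c i (\<sigma>(j := - \<sigma> j)) = c i \<sigma>"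
  shows "(\<Sum>\<sigma>\<in>signs J. h \<sigma> * exp (\<Sum>i\<in>I. \<sigma> i * c i \<sigma>))
    \<le> (\<Sum>\<sigma>\<in>signs J. h \<sigma> * exp ((\<Sum>i\<in>I. (c i \<sigma>)\<^sup>2) / 2))"
  using assms
proof (induction I arbitrary: h rule: finite_induct)
  case empty
  then show ?case by simp
next
  case (insert j I)
  define g where "g \<sigma> = h \<sigma> * exp (\<Sum>i\<in>I. \<sigma> i * c i \<sigma>)" for \<sigma>
  have j: "j \<in> J" using insert by auto
  have split: "h \<sigma> * exp (\<Sum>i\<in>insert j I. \<sigma> i * c i \<sigma>) = g \<sigma> * exp (\<sigma> j * c j \<sigma>)" for \<sigma>
    using insert.hyps by (simp add: g_def exp_add)
  have g_flip: "g (\<sigma>(j := - \<sigma> j)) = g \<sigma>" if "\<sigma> \<in> signs J" for \<sigma>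
  proof -
    have "(\<Sum>i\<in>I. (\<sigma>(j := - \<sigma> j)) i * c i (\<sigma>(j := - \<sigma> j))) = (\<Sum>i\<in>I. \<sigma> i * c i \<sigma>)"
    proof (intro sum.cong refl)
      fix i assume "i \<in> I"
      then have "(\<sigma>(j := - \<sigma> j)) i = \<sigma> i"
        using insert.hyps by auto
      then show "(\<sigma>(j := - \<sigma> j)) i * c i (\<sigma>(j := - \<sigma> j)) = \<sigma> i * c i \<sigma>"
        using insert.prems(4)[OF that insertI1] by (simp only:)
    qed
    then show ?thesis
      using insert.prems(3)[OF that insertI1] by (simp only: g_def)
  qed
  \<comment> \<open>Pairing each pattern with its flip at \<open>j\<close> replaces
    \<open>exp\<close> by \<open>cosh\<close>.\<close>
  have "(\<Sum>\<sigma>\<in>signs J. g \<sigma> * exp (\<sigma> j * c j \<sigma>))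
      = (\<Sum>\<sigma>\<in>signs J. g (\<sigma>(j := - \<sigma> j)) * exp ((\<sigma>(j := - \<sigma> j)) j * c j (\<sigma>(j := - \<sigma> j))))"
    by (rule sum_signs_flip[OF j, symmetric])
  also have "\<dots> = (\<Sum>\<sigma>\<in>signs J. g \<sigma> * exp (- (\<sigma> j * c j \<sigma>)))"
  proof (intro sum.cong refl)
    fix \<sigma> assume \<sigma>: "\<sigma> \<in> signs J"
    show "g (\<sigma>(j := - \<sigma> j)) * exp ((\<sigma>(j := - \<sigma> j)) j * c j (\<sigma>(j := - \<sigma> j)))
      = g \<sigma> * exp (- (\<sigma> j * c j \<sigma>))"
      by (simp only: g_flip[OF \<sigma>] insert.prems(4)[OF \<sigma> insertI1] fun_upd_same mult_minus_left)
  qed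
  finally have "2 * (\<Sum>\<sigma>\<in>signs J. g \<sigma> * exp (\<sigma> j * c j \<sigma>))
      = (\<Sum>\<sigma>\<in>signs J. g \<sigma> * exp (\<sigma> j * c j \<sigma>)) + (\<Sum>\<sigma>\<in>signs J. g \<sigma> * exp (- (\<sigma> j * c j \<sigma>)))"
    by simp
  also have "\<dots> = 2 * (\<Sum>\<sigma>\<in>signs J. g \<sigma> * cosh (\<sigma> j * c j \<sigma>))"
    by (simp add: sum.distrib[symmetric] sum_distrib_left cosh_def algebra_simps)
  finally have "(\<Sum>\<sigma>\<in>signs J. g \<sigma> * exp (\<sigma> j * c j \<sigma>))
      = (\<Sum>\<sigma>\<in>signs J. g \<sigma> * cosh (\<sigma> j * c j \<sigma>))" by simp
  also have "\<dots> \<le> (\<Sum>\<sigma>\<in>signs J. g \<sigma> * exp ((c j \<sigma>)\<^sup>2 / 2))"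
  proof (intro sum_mono mult_left_mono)
    fix \<sigma> assume \<sigma>: "\<sigma> \<in> signs J"
    have "(\<sigma> j)\<^sup>2 = 1"
      using signs_square[OF \<sigma>] by (simp add: power2_eq_square)
    then show "cosh (\<sigma> j * c j \<sigma>) \<le> exp ((c j \<sigma>)\<^sup>2 / 2)"
      using cosh_le_exp_square[of "\<sigma> j * c j \<sigma>"] by (simp add: power_mult_distrib)
    show "0 \<le> g \<sigma>"
      using insert.prems(2)[OF \<sigma>] by (simp add: g_def)
  qed
  also have "\<dots> = (\<Sum>\<sigma>\<in>signs J. (h \<sigma> * exp ((c j \<sigma>)\<^sup>2 / 2)) * exp (\<Sum>i\<in>I. \<sigma> i * c i \<sigma>))"
    by (simp add: g_def mult_ac)
  also have "\<dots> \<le> (\<Sum>\<sigma>\<in>signs J. (h \<sigma> * exp ((c j \<sigma>)\<^sup>2 / 2)) * exp ((\<Sum>i\<in>I. (c i \<sigma>)\<^sup>2) / 2))"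
    by (rule insert.IH) (use insert.prems in auto)
  also have "\<dots> = (\<Sum>\<sigma>\<in>signs J. h \<sigma> * exp ((\<Sum>i\<in>insert j I. (c i \<sigma>)\<^sup>2) / 2))"
    using insert.hyps by (simp add: add_divide_distrib exp_add mult_ac)
  finally show ?case
    using split by simp
qed

text \<open>Conditionally on the signs outside \<open>I\<close>, the ratio is a Rademacher sum with coefficients of
  norm at most 1 (it is 0 where \<open>s \<sigma> = 0\<close>).\<close>

lemma avg_exp_scaled_le:
  fixes c :: "'j \<Rightarrow> ('j \<Rightarrow> real) \<Rightarrow> real"
  assumes J: "finite J" and I: "I \<subseteq> J"
    and s: "\<And>\<sigma> j. \<sigma> \<in> signs J \<Longrightarrow> j \<in> I \<Longrightarrow> s (\<sigma>(j := - \<sigma> j)) = s \<sigma>"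
    and c: "\<And>\<sigma> i j. \<sigma> \<in> signs J \<Longrightarrow> j \<in> I \<Longrightarrow> c i (\<sigma>(j := - \<sigma> j)) = c i \<sigma>"
    and le: "\<And>\<sigma>. \<sigma> \<in> signs J \<Longrightarrow> (\<Sum>i\<in>I. (c i \<sigma>)\<^sup>2) \<le> (s \<sigma>)\<^sup>2"
  shows "avg (signs J) (\<lambda>\<sigma>. exp (l * ((\<Sum>i\<in>I. \<sigma> i * c i \<sigma>) / s \<sigma>))) \<le> exp (l\<^sup>2 / 2)"
proof -
  have fin: "finite I" using J I finite_subset by blast
  have "avg (signs J) (\<lambda>\<sigma>. exp (l * ((\<Sum>i\<in>I. \<sigma> i * c i \<sigma>) / s \<sigma>)))
      = (\<Sum>\<sigma>\<in>signs J. 1 * exp (\<Sum>i\<in>I. \<sigma> i * (l * c i \<sigma> / s \<sigma>))) / card (signs J)"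
    unfolding avg_def by (simp add: sum_distrib_left sum_divide_distrib mult_ac)
  also have "\<dots> \<le> (\<Sum>\<sigma>\<in>signs J. 1 * exp ((\<Sum>i\<in>I. (l * c i \<sigma> / s \<sigma>)\<^sup>2) / 2)) / card (signs J)"
    by (intro divide_right_mono sum_signs_exp_le) (auto simp: fin I s c)
  also have "\<dots> = avg (signs J) (\<lambda>\<sigma>. exp ((\<Sum>i\<in>I. (l * c i \<sigma> / s \<sigma>)\<^sup>2) / 2))"
    by (simp add: avg_def)
  also have "\<dots> \<le> avg (signs J) (\<lambda>_. exp (l\<^sup>2 / 2))"
  proof (rule avg_mono)
    fix \<sigma> assume \<sigma>: "\<sigma> \<in> signs J"
    have "(\<Sum>i\<in>I. (l * c i \<sigma> / s \<sigma>)\<^sup>2) = l\<^sup>2 * ((\<Sum>i\<in>I. (c i \<sigma>)\<^sup>2) / (s \<sigma>)\<^sup>2)"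
      by (simp add: power_mult_distrib power_divide sum_distrib_left sum_divide_distrib)
    also have "\<dots> \<le> l\<^sup>2 * 1"
      using le[OF \<sigma>] by (intro mult_left_mono) (auto simp: divide_le_eq_1)
    finally show "exp ((\<Sum>i\<in>I. (l * c i \<sigma> / s \<sigma>)\<^sup>2) / 2) \<le> exp (l\<^sup>2 / 2)"
      by simp
  qed
  also have "\<dots> = exp (l\<^sup>2 / 2)"
    by (simp add: avg_const finite_signs J signs_nonempty)
  finally show ?thesis .
qed

subsection \<open>Maxima of subgaussian families\<close>

lemma exp_ge_half_square:
  fixes z :: real
  assumes "0 \<le> z"
  shows "z\<^sup>2 / 2 \<le> exp z"
  using exp_lower_Taylor_quadratic[OF assms] assms by linarith

text \<open>The weights \<open>exp (- 8 * 2 ^ n)\<close> beat the cardinalities \<open>2 ^ 2 ^ (n + 2)\<close>, so the sum \<open>G\<close> of all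
  weighted exponentials has bounded average; each single term bounds one \<open>\<bar>f s\<bar>\<close>.\<close>

lemma subgaussian_families_bound:
  fixes Fam :: "nat \<Rightarrow> ('w \<Rightarrow> real) set"
  assumes S: "finite S" "S \<noteq> {}"
    and fin: "\<And>n. finite (Fam n)"
    and card: "\<And>n. card (Fam n) \<le> 2 ^ (2 ^ (n + 2))"
    and mgf: "\<And>n f l. f \<in> Fam n \<Longrightarrow> avg S (\<lambda>s. exp (l * f s)) \<le> exp (l\<^sup>2 / 2)"
  obtains U where "\<And>s. 0 \<le> U s" "avg S (\<lambda>s. (U s)\<^sup>2) \<le> 136"
    "\<And>n f s. f \<in> Fam n \<Longrightarrow> s \<in> S \<Longrightarrow> \<bar>f s\<bar> \<le> 2 powr (real n / 2) * U s"
proof -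
  define q where "q n = 2 powr (real n / 2)" for n :: nat
  have q_sq: "(q n)\<^sup>2 = 2 ^ n" for n
    by (simp add: q_def power2_eq_square powr_add[symmetric] powr_realpow)
  have q_pos: "q n > 0" for n
    by (simp add: q_def)
  \<comment> \<open>The exponential parameter is \<open>q n\<close>, whose square is
    \<open>2 ^ n\<close>. In units of \<open>2 ^ n\<close> the exponents are 4 from the cardinality
    (as \<open>2 \<le> exp 1\<close>), 1/2 from the moment generating function and -8 from the
    weight, so -7/2 remains.\<close>
  define tm where "tm n s = (\<Sum>f\<in>Fam n. exp (q n * f s) + exp (- q n * f s)) * exp (- (8 * 2 ^ n))" for n s
  have term_nonneg: "0 \<le> tm n s" for n s
    by (auto simp: tm_def intro!: sum_nonneg mult_nonneg_nonneg add_nonneg_nonneg)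
  have avg_term: "avg S (tm n) \<le> (1 / 2) ^ n" for n
  proof -
    have "avg S (tm n) = exp (- (8 * 2 ^ n)) *
        (\<Sum>f\<in>Fam n. avg S (\<lambda>s. exp (q n * f s)) + avg S (\<lambda>s. exp (- q n * f s)))"
      unfolding tm_def avg_add[symmetric] avg_sum[symmetric] avg_cmult[symmetric]
      by (simp add: mult.commute)
    also have "\<dots> \<le> exp (- (8 * 2 ^ n)) * (\<Sum>f\<in>Fam n. exp ((q n)\<^sup>2 / 2) + exp ((- q n)\<^sup>2 / 2))"
      by (intro mult_left_mono sum_mono add_mono mgf) auto
    also have "\<dots> = exp (- (8 * 2 ^ n)) * (real (card (Fam n)) * (2 * exp (2 ^ n / 2)))"
      by (simp add: q_sq)
    also have "\<dots> \<le> exp (- (8 * 2 ^ n)) * (exp (4 * 2 ^ n) * (2 * exp (2 ^ n / 2)))"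
    proof (intro mult_left_mono mult_right_mono)
      have "real (card (Fam n)) \<le> real (2 ^ (2 ^ (n + 2)))"
        using card[of n] by (subst of_nat_le_iff)
      also have "\<dots> = 2 ^ (2 ^ (n + 2))" by simp
      also have "\<dots> \<le> exp 1 ^ (2 ^ (n + 2))"
        using exp_ge_add_one_self[of 1] by (intro power_mono) auto
      also have "\<dots> = exp (4 * 2 ^ n)"
        by (simp add: exp_of_nat_mult[symmetric] mult.commute)
      finally show "real (card (Fam n)) \<le> exp (4 * 2 ^ n)" .
    qed auto
    also have "\<dots> = 2 * exp (- (7 / 2 * 2 ^ n))"
      by (simp add: exp_add[symmetric] field_simps)
    also have "\<dots> \<le> 2 * exp (- real (Suc n))"
    proof -
      have "real (Suc n) \<le> 2 ^ n"
        using less_exp[of n] by (metis Suc_leI of_nat_le_iff of_nat_numeral of_nat_power)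
      moreover have "(2::real) ^ n \<le> 7 / 2 * 2 ^ n"
        by simp
      ultimately have "real (Suc n) \<le> 7 / 2 * 2 ^ n"
        by (rule order_trans)
      then show ?thesis by simp
    qed
    also have "\<dots> = 2 * (exp (- 1) ^ Suc n)"
      using exp_of_nat_mult[of "Suc n" "-1::real"] by simp
    also have "\<dots> \<le> 2 * ((1 / 2) ^ Suc n)"
      using exp_ge_add_one_self[of 1]
      by (intro mult_left_mono power_mono) (auto simp: exp_minus field_simps)
    finally show ?thesis by simp
  qed
  have card_S: "real (card S) > 0"
    using S by (simp add: card_gt_0_iff)
  have term_le: "tm n s \<le> card S * (1 / 2) ^ n" if "s \<in> S" for n s
  proof -
    have "tm n s \<le> (\<Sum>s\<in>S. tm n s)"
      using S that by (intro member_le_sum) (auto simp: term_nonneg)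
    also have "\<dots> \<le> card S * (1 / 2) ^ n"
      using avg_term[of n] card_S by (simp add: avg_def field_simps)
    finally show ?thesis .
  qed
  have summable: "summable (\<lambda>n. tm n s)" if "s \<in> S" for s
    by (rule summable_comparison_test'[where N=0 and g="\<lambda>n. card S * (1 / 2) ^ n"])
       (use term_le[OF that] term_nonneg in \<open>auto intro!: summable_mult summable_geometric\<close>)
  define G where "G s = (\<Sum>n. tm n s)" for s
  have G_ge: "tm n s \<le> G s" if "s \<in> S" for n s
    unfolding G_def using summable[OF that] sum_le_suminf[of "\<lambda>n. tm n s" "{n}"] by (simp add: term_nonneg)
  have avg_G: "avg S G \<le> 2"
  proof -
    have "(\<lambda>n. avg S (tm n)) sums avg S G"
      unfolding avg_def G_def by (intro sums_divide sums_sum summable_sums summable)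
    moreover have "(\<lambda>n. (1 / 2) ^ n) sums (2::real)"
      using geometric_sums[of "1/2::real"] by simp
    ultimately show ?thesis
      using avg_term by (rule sums_le[rotated])
  qed
  \<comment> \<open>The 8 undoes the weight in \<open>tm\<close>, and the square root inverts
    \<open>exp_ge_half_square\<close>, so a first moment of \<open>G\<close> yields a second moment
    of \<open>U\<close>: \<open>2 * 8\<^sup>2 + 4 * 2 = 136\<close>. The absolute value keeps
    \<open>U\<close> nonnegative outside \<open>S\<close>, where the series is not
    controlled.\<close>
  define U where "U s = 8 + sqrt (2 * \<bar>G s\<bar>)" for s
  show thesis
  proof
    show "0 \<le> U s" for s
      by (simp add: U_def)
    have "avg S (\<lambda>s. (U s)\<^sup>2) \<le> avg S (\<lambda>s. 128 + 4 * G s)"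
    proof (rule avg_mono)
      fix s assume "s \<in> S"
      then have "0 \<le> G s" using G_ge[of s 0] term_nonneg[of 0 s] by linarith
      moreover have "(U s)\<^sup>2 \<le> 2 * 8\<^sup>2 + 2 * (sqrt (2 * \<bar>G s\<bar>))\<^sup>2"
        using zero_le_power2[of "8 - sqrt (2 * \<bar>G s\<bar>)"] by (simp add: U_def power2_eq_square algebra_simps)
      ultimately show "(U s)\<^sup>2 \<le> 128 + 4 * G s"
        by simp
    qed
    also have "\<dots> = 128 + 4 * avg S G"
      using S by (simp add: avg_add avg_cmult avg_const)
    finally show "avg S (\<lambda>s. (U s)\<^sup>2) \<le> 136"
      using avg_G by simp
  next
    fix n f s assume f: "f \<in> Fam n" and s: "s \<in> S"
    define z where "z = q n * \<bar>f s\<bar> - 8 * 2 ^ n"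
    have "exp z \<le> (exp (q n * f s) + exp (- q n * f s)) * exp (- (8 * 2 ^ n))"
      by (cases "f s \<ge> 0") (auto simp: z_def exp_diff exp_minus field_simps)
    also have "\<dots> \<le> tm n s"
      unfolding tm_def using f fin
      by (intro mult_right_mono member_le_sum[where f="\<lambda>f. exp (q n * f s) + exp (- q n * f s)"])
         (auto intro: add_nonneg_nonneg)
    also have "\<dots> \<le> G s" by (rule G_ge[OF s])
    finally have *: "exp z \<le> G s" .
    have "z \<le> sqrt (2 * \<bar>G s\<bar>)"
    proof (cases "z \<ge> 0")
      case True
      have "z\<^sup>2 \<le> 2 * \<bar>G s\<bar>"
        using exp_ge_half_square[OF True] * by linarith
      then show ?thesis by (rule real_le_rsqrt)
    qed (smt (verit) real_sqrt_ge_zero)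
    also have "\<dots> \<le> 2 ^ n * sqrt (2 * \<bar>G s\<bar>)"
      by (intro mult_le_cancel_right1[THEN iffD2]) auto
    finally have "q n * \<bar>f s\<bar> \<le> 2 ^ n * U s"
      by (simp add: z_def U_def algebra_simps)
    also have "\<dots> = q n * (q n * U s)"
      by (simp add: q_sq[symmetric] power2_eq_square)
    finally show "\<bar>f s\<bar> \<le> 2 powr (real n / 2) * U s"
      using q_pos[of n] by (simp add: q_def)
  qed
qed

subsection \<open>Decoupling\<close>

definition block_sum :: "nat \<Rightarrow> (nat \<times> nat \<Rightarrow> complex) \<Rightarrow> (nat \<times> nat \<Rightarrow> real) \<Rightarrow> nat \<Rightarrow> complex" where
  "block_sum B v s b = (\<Sum>i<B. of_real (s (b, i)) * v (b, i))"

text \<open>For \<open>v\<close> the entries of \<open>A x\<close> arranged in blocks, this is the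
  \<open>N x \<sigma>\<close> of the overview. The pattern \<open>s\<close> is arbitrary because
  masked patterns, which contain zeros, are inserted as well.\<close>

definition energy :: "nat \<Rightarrow> nat \<Rightarrow> (nat \<times> nat \<Rightarrow> complex) \<Rightarrow> (nat \<times> nat \<Rightarrow> real) \<Rightarrow> real" where
  "energy m B v s = (\<Sum>b<m. (cmod (block_sum B v s b))\<^sup>2)"

definition cross :: "nat \<Rightarrow> nat \<Rightarrow> (nat \<times> nat \<Rightarrow> complex) \<Rightarrow> (nat \<times> nat \<Rightarrow> complex) \<Rightarrow>
    (nat \<times> nat \<Rightarrow> real) \<Rightarrow> (nat \<times> nat \<Rightarrow> real) \<Rightarrow> real" where
  "cross m B u w p q = (\<Sum>b<m. Re (block_sum B u p b * cnj (block_sum B w q b)))"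

definition masked :: "'j set \<Rightarrow> ('j \<Rightarrow> real) \<Rightarrow> 'j \<Rightarrow> real" where
  "masked I s j = (if j \<in> I then s j else 0)"

lemma energy_nonneg: "0 \<le> energy m B v s"
  unfolding energy_def by (intro sum_nonneg) auto

lemma cross_commute: "cross m B u w p q = cross m B w u q p"
  unfolding cross_def by (intro sum.cong) (auto simp: algebra_simps)

lemma block_sum_diff: "block_sum B (\<lambda>j. u j - w j) s b = block_sum B u s b - block_sum B w s b"
  unfolding block_sum_def by (simp add: algebra_simps sum_subtractf)

text \<open>Telescoping a quadratic expression gives two bilinear terms. In the second one the
  patterns are exchanged so that the increment always occupies the first slot; one tail estimate
  then serves both \<open>I\<close> and its complement.\<close>

lemma cross_self_diff:
  "cross m B u u p q - cross m B w w p q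
    = cross m B (\<lambda>j. u j - w j) u p q + cross m B (\<lambda>j. u j - w j) w q p"
  unfolding cross_commute[of m B "\<lambda>j. u j - w j" w q p]
  unfolding cross_def block_sum_diff sum_subtractf[symmetric] sum.distrib[symmetric]
  by (intro sum.cong) (auto simp: algebra_simps)

lemma block_sum_masked:
  assumes "\<tau> \<in> signs J"
  defines "I \<equiv> {j. \<tau> j = 1}"
  shows "block_sum B v \<sigma> b = block_sum B v (masked I \<sigma>) b + block_sum B v (masked (- I) \<sigma>) b"
    and "block_sum B v (\<lambda>j. \<tau> j * \<sigma> j) b = block_sum B v (masked I \<sigma>) b - block_sum B v (masked (- I) \<sigma>) b"
proof -
  show "block_sum B v \<sigma> b = block_sum B v (masked I \<sigma>) b + block_sum B v (masked (- I) \<sigma>) b"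
    unfolding block_sum_def sum.distrib[symmetric] by (intro sum.cong) (auto simp: masked_def)
  have "\<tau> j = (if j \<in> I then 1 else -1)" for j
    using signsD[OF assms(1), of j] by (auto simp: I_def)
  then show "block_sum B v (\<lambda>j. \<tau> j * \<sigma> j) b = block_sum B v (masked I \<sigma>) b - block_sum B v (masked (- I) \<sigma>) b"
    unfolding block_sum_def sum_subtractf[symmetric] by (intro sum.cong) (auto simp: masked_def)
qed

text \<open>Polarization: passing from \<open>\<sigma>\<close> to \<open>\<tau> * \<sigma>\<close>
  turns \<open>a + c\<close> into \<open>a - c\<close>, where \<open>a\<close> and \<open>c\<close>
  are the parts of a block sum inside and outside \<open>I\<close>. The diagonal cancels exactly, so
  this decoupling is an identity.\<close>

lemma energy_diff:
  assumes "\<tau> \<in> signs J"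
  defines "I \<equiv> {j. \<tau> j = 1}"
  shows "energy m B v \<sigma> - energy m B v (\<lambda>j. \<tau> j * \<sigma> j) = 4 * cross m B v v (masked I \<sigma>) (masked (- I) \<sigma>)"
proof -
  have "(cmod (a + c))\<^sup>2 - (cmod (a - c))\<^sup>2 = 4 * Re (a * cnj c)" for a c
    unfolding cmod_power2 by (simp add: power2_eq_square algebra_simps)
  then show ?thesis
    unfolding energy_def cross_def sum_distrib_left sum_subtractf[symmetric] I_def
      block_sum_masked(1)[OF assms(1), of B v \<sigma>] block_sum_masked(2)[OF assms(1)] by simp
qed

text \<open>The parallelogram law. It leads from masked patterns back to genuine sign patterns,
  where the supremum to be absorbed lives.\<close>

lemma energy_masked_le:
  assumes "\<tau> \<in> signs J"
  defines "I \<equiv> {j. \<tau> j = 1}"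
  shows "energy m B v (masked I \<sigma>) \<le> (energy m B v \<sigma> + energy m B v (\<lambda>j. \<tau> j * \<sigma> j)) / 2"
    and "energy m B v (masked (- I) \<sigma>) \<le> (energy m B v \<sigma> + energy m B v (\<lambda>j. \<tau> j * \<sigma> j)) / 2"
proof -
  have "(cmod (a + c))\<^sup>2 + (cmod (a - c))\<^sup>2 = 2 * (cmod a)\<^sup>2 + 2 * (cmod c)\<^sup>2" for a c
    unfolding cmod_power2 by (simp add: power2_eq_square algebra_simps)
  then have "energy m B v \<sigma> + energy m B v (\<lambda>j. \<tau> j * \<sigma> j)
      = 2 * energy m B v (masked I \<sigma>) + 2 * energy m B v (masked (- I) \<sigma>)"
    unfolding energy_def sum_distrib_left sum.distrib[symmetric] I_def
      block_sum_masked(1)[OF assms(1), of B v \<sigma>] block_sum_masked(2)[OF assms(1)] by simp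
  with energy_nonneg[of m B v "masked I \<sigma>"] energy_nonneg[of m B v "masked (- I) \<sigma>"]
  show "energy m B v (masked I \<sigma>) \<le> (energy m B v \<sigma> + energy m B v (\<lambda>j. \<tau> j * \<sigma> j)) / 2"
    and "energy m B v (masked (- I) \<sigma>) \<le> (energy m B v \<sigma> + energy m B v (\<lambda>j. \<tau> j * \<sigma> j)) / 2"
    by (simp_all add: field_simps)
qed

lemma avg_energy:
  "avg (signs ({..<m} \<times> {..<B})) (energy m B v) = (\<Sum>j\<in>{..<m} \<times> {..<B}. (cmod (v j))\<^sup>2)"
proof -
  let ?J = "{..<m} \<times> {..<B}"
  have eq: "energy m B v \<sigma>
      = (\<Sum>b<m. \<Sum>i<B. \<Sum>k<B. Re (v (b, i) * cnj (v (b, k))) * (\<sigma> (b, i) * \<sigma> (b, k)))" for \<sigma>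
  proof -
    have "(cmod z)\<^sup>2 = Re (z * cnj z)" for z
      unfolding cmod_power2 by (simp add: power2_eq_square)
    moreover have "Re (of_real r * x * cnj (of_real s * y)) = Re (x * cnj y) * (r * s)" for r s x y
      by (simp add: algebra_simps)
    ultimately show ?thesis
      unfolding energy_def block_sum_def by (simp only: cnj_sum sum_product Re_sum)
  qed
  have "avg (signs ?J) (energy m B v) = (\<Sum>b<m. \<Sum>i<B. \<Sum>k<B.
      Re (v (b, i) * cnj (v (b, k))) * avg (signs ?J) (\<lambda>\<sigma>. \<sigma> (b, i) * \<sigma> (b, k)))"
    by (subst avg_cong[OF eq]) (simp only: avg_sum avg_cmult)
  also have "\<dots> = (\<Sum>b<m. \<Sum>i<B. \<Sum>k<B. if i = k then (cmod (v (b, i)))\<^sup>2 else 0)"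
    unfolding cmod_power2
    by (intro sum.cong refl) (auto simp: avg_signs_product power2_eq_square)
  also have "\<dots> = (\<Sum>j\<in>?J. (cmod (v j))\<^sup>2)"
    by (simp add: sum.cartesian_product split_def)
  finally show ?thesis .
qed

text \<open>Cauchy-Schwarz in each block. The factor \<open>B\<close> is wasteful but enters no
  final constant: the bound only makes suprema finite.\<close>

lemma energy_le:
  assumes "\<sigma> \<in> signs J"
  shows "energy m B v \<sigma> \<le> real B * (\<Sum>j\<in>{..<m} \<times> {..<B}. (cmod (v j))\<^sup>2)"
proof -
  have "(cmod (block_sum B v \<sigma> b))\<^sup>2 \<le> real B * (\<Sum>i<B. (cmod (v (b, i)))\<^sup>2)" for b
  proof -
    have "\<bar>\<sigma> (b, i)\<bar> = 1" for i
      using signsD[OF assms, of "(b, i)"] by auto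
    then have "cmod (block_sum B v \<sigma> b) \<le> (\<Sum>i<B. cmod (v (b, i)))"
      unfolding block_sum_def by (intro order_trans[OF norm_sum]) (simp add: norm_mult)
    then have "(cmod (block_sum B v \<sigma> b))\<^sup>2 \<le> (\<Sum>i<B. cmod (v (b, i)))\<^sup>2"
      by (intro power_mono) auto
    also have "\<dots> \<le> real (card {..<B}) * (\<Sum>i<B. (cmod (v (b, i)))\<^sup>2)"
      using sum_squared_le_sum_of_squares[of "\<lambda>i. cmod (v (b, i))" "{..<B}"] by (simp add: mult.commute)
    finally show ?thesis by simp
  qed
  then have "energy m B v \<sigma> \<le> (\<Sum>b<m. real B * (\<Sum>i<B. (cmod (v (b, i)))\<^sup>2))"
    unfolding energy_def by (rule sum_mono)
  then show ?thesis
    by (simp add: sum.cartesian_product split_def sum_distrib_left)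
qed

text \<open>Division by 0 yields 0, so a normalised increment says nothing where its scale vanishes.
  There the increment itself vanishes, whichever factor of the scale is 0.\<close>

lemma cross_eq_0:
  assumes "\<And>b. b < m \<Longrightarrow> (\<Sum>i<B. (cmod (u (b, i)))\<^sup>2) \<le> r\<^sup>2" "r * sqrt (energy m B w q) = 0"
  shows "cross m B u w p q = 0"
proof (cases "r = 0")
  case True
  have "u (b, i) = 0" if "b < m" "i < B" for b i
  proof -
    have "(cmod (u (b, i)))\<^sup>2 \<le> (\<Sum>i<B. (cmod (u (b, i)))\<^sup>2)"
      using that by (intro member_le_sum) auto
    also have "\<dots> \<le> 0"
      using assms(1)[OF that(1)] True by simp
    finally show ?thesis by simp
  qed
  then show ?thesis
    by (simp add: cross_def block_sum_def)
next
  case False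
  then have "energy m B w q = 0" using assms(2) by simp
  then have "\<forall>b<m. block_sum B w q b = 0"
    unfolding energy_def by (simp add: sum_nonneg_eq_0_iff)
  then show ?thesis by (simp add: cross_def)
qed

text \<open>The cross term is linear in the signs of \<open>I\<close>, with coefficients fixed by
  the complementary half. Their squares are summed block by block: the uniform bound
  \<open>r\<^sup>2\<close> for a block multiplies that block's share of the energy. This is why a
  maximum over blocks suffices as the metric.\<close>

lemma avg_exp_cross_le:
  assumes "\<And>b. b < m \<Longrightarrow> (\<Sum>i<B. (cmod (u (b, i)))\<^sup>2) \<le> r\<^sup>2"
  shows "avg (signs ({..<m} \<times> {..<B})) (\<lambda>\<sigma>. exp (l *
      (cross m B u w (masked I \<sigma>) (masked (- I) \<sigma>) / (r * sqrt (energy m B w (masked (- I) \<sigma>))))))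
    \<le> exp (l\<^sup>2 / 2)"
proof -
  let ?J = "{..<m} \<times> {..<B}"
  define c where "c j \<sigma> = Re (u j * cnj (block_sum B w (masked (- I) \<sigma>) (fst j)))" for j \<sigma>
  have flip: "masked (- I) (\<sigma>(j := - \<sigma> j)) = masked (- I) \<sigma>" if "j \<in> ?J \<inter> I" for \<sigma> j
    using that by (auto simp: masked_def)
  have eq: "cross m B u w (masked I \<sigma>) (masked (- I) \<sigma>) = (\<Sum>j\<in>?J \<inter> I. \<sigma> j * c j \<sigma>)" for \<sigma>
  proof -
    have "cross m B u w (masked I \<sigma>) (masked (- I) \<sigma>) = (\<Sum>b<m. \<Sum>i<B. masked I \<sigma> (b, i) * c (b, i) \<sigma>)"
      unfolding cross_def block_sum_def[of B u] c_def
      by (intro sum.cong refl) (simp add: sum_distrib_right sum_distrib_left algebra_simps sum.distrib)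
    also have "\<dots> = (\<Sum>j\<in>?J. masked I \<sigma> j * c j \<sigma>)"
      by (simp add: sum.cartesian_product split_def)
    also have "\<dots> = (\<Sum>j\<in>?J \<inter> I. \<sigma> j * c j \<sigma>)"
      by (simp add: masked_def if_distrib[of "\<lambda>x. x * _"] sum.If_cases cong: if_cong)
    finally show ?thesis .
  qed
  have le: "(\<Sum>j\<in>?J \<inter> I. (c j \<sigma>)\<^sup>2) \<le> (r * sqrt (energy m B w (masked (- I) \<sigma>)))\<^sup>2" for \<sigma>
  proof -
    let ?y = "\<lambda>b. (cmod (block_sum B w (masked (- I) \<sigma>) b))\<^sup>2"
    have "(c (b, i) \<sigma>)\<^sup>2 \<le> (cmod (u (b, i)))\<^sup>2 * ?y b" for b i
      unfolding c_def power_mult_distrib[symmetric]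
      using abs_Re_le_cmod[of "u (b, i) * cnj (block_sum B w (masked (- I) \<sigma>) b)"]
      by (simp add: norm_mult abs_le_square_iff[symmetric])
    then have "(\<Sum>b<m. \<Sum>i<B. (c (b, i) \<sigma>)\<^sup>2) \<le> (\<Sum>b<m. \<Sum>i<B. (cmod (u (b, i)))\<^sup>2 * ?y b)"
      by (intro sum_mono)
    also have "\<dots> = (\<Sum>b<m. (\<Sum>i<B. (cmod (u (b, i)))\<^sup>2) * ?y b)"
      by (simp add: sum_distrib_right)
    also have "\<dots> \<le> (\<Sum>b<m. r\<^sup>2 * ?y b)"
      using assms by (intro sum_mono mult_right_mono) auto
    also have "\<dots> = (r * sqrt (energy m B w (masked (- I) \<sigma>)))\<^sup>2"
      using energy_nonneg[of m B w "masked (- I) \<sigma>"]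
      by (simp add: power_mult_distrib energy_def sum_distrib_left)
    finally have "(\<Sum>b<m. \<Sum>i<B. (c (b, i) \<sigma>)\<^sup>2) \<le> (r * sqrt (energy m B w (masked (- I) \<sigma>)))\<^sup>2" .
    moreover have "(\<Sum>j\<in>?J \<inter> I. (c j \<sigma>)\<^sup>2) \<le> (\<Sum>j\<in>?J. (c j \<sigma>)\<^sup>2)"
      by (intro sum_mono2) auto
    ultimately show ?thesis
      by (simp add: sum.cartesian_product split_def)
  qed
  show ?thesis
    unfolding eq by (intro avg_exp_scaled_le le) (auto simp: c_def flip simp del: fun_upd_apply)
qed

subsection \<open>Generic chaining\<close>

definition chaos :: "nat \<Rightarrow> nat \<Rightarrow> (nat \<times> nat \<Rightarrow> complex) \<Rightarrow> (nat \<times> nat \<Rightarrow> real) \<Rightarrow> real" where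
  "chaos m B u \<sigma> = energy m B u \<sigma> - (\<Sum>j\<in>{..<m} \<times> {..<B}. (cmod (u j))\<^sup>2)"

definition sup_chaos :: "nat \<Rightarrow> nat \<Rightarrow> ('x \<Rightarrow> nat \<times> nat \<Rightarrow> complex) \<Rightarrow> 'x set \<Rightarrow> (nat \<times> nat \<Rightarrow> real) \<Rightarrow> real" where
  "sup_chaos m B v T \<sigma> = (SUP t\<in>T. \<bar>chaos m B (v t) \<sigma>\<bar>)"

text \<open>A real supremum is known to dominate its family only if the family is bounded, which
  \<open>energy_le\<close> ensures.\<close>

lemma abs_chaos_le_sup_chaos:
  assumes \<sigma>: "\<sigma> \<in> signs J" and t: "t \<in> T"
    and frob: "\<And>x. x \<in> T \<Longrightarrow> (\<Sum>j\<in>{..<m} \<times> {..<B}. (cmod (v x j))\<^sup>2) \<le> R"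
  shows "\<bar>chaos m B (v t) \<sigma>\<bar> \<le> sup_chaos m B v T \<sigma>"
proof -
  have "\<bar>chaos m B (v x) \<sigma>\<bar> \<le> real B * R + R" if "x \<in> T" for x
  proof -
    have "energy m B (v x) \<sigma> \<le> real B * R"
      using energy_le[OF \<sigma>, of m B "v x"] frob[OF that]
      by (meson mult_left_mono of_nat_0_le_iff order_trans)
    moreover have "0 \<le> (\<Sum>j\<in>{..<m} \<times> {..<B}. (cmod (v x j))\<^sup>2)"
      by (intro sum_nonneg) auto
    ultimately show ?thesis
      unfolding chaos_def using frob[OF that] energy_nonneg[of m B "v x" \<sigma>] by linarith
  qed
  then show ?thesis
    unfolding sup_chaos_def by (intro cSUP_upper t bdd_aboveI2)
qed

text \<open>\<open>F\<close> stands for the supremum of \<open>\<parallel>A x\<parallel>\<close> and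
  \<open>G\<close> for a multiple of \<open>gamma2\<close>. Level 0 is a single point at which the
  process vanishes. The link from level \<open>n\<close> to \<open>Suc n\<close> carries the weight
  of its lower end.\<close>

locale chaining =
  fixes m B :: nat and T :: "'x set" and v :: "'x \<Rightarrow> nat \<times> nat \<Rightarrow> complex"
    and \<rho> :: "'x \<Rightarrow> 'x \<Rightarrow> real" and x0 :: 'x
    and S :: "nat \<Rightarrow> 'x set" and \<pi> :: "nat \<Rightarrow> 'x \<Rightarrow> 'x" and F G :: real
  assumes frob: "x \<in> T \<Longrightarrow> (\<Sum>j\<in>{..<m} \<times> {..<B}. (cmod (v x j))\<^sup>2) \<le> F\<^sup>2"
    and lipschitz: "\<lbrakk>x \<in> T; y \<in> T; b < m\<rbrakk> \<Longrightarrow> (\<Sum>i<B. (cmod (v y (b, i) - v x (b, i)))\<^sup>2) \<le> (\<rho> x y)\<^sup>2"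
    and dist_nonneg: "0 \<le> \<rho> x y"
    and base: "x0 \<in> T" "\<And>j. j \<in> {..<m} \<times> {..<B} \<Longrightarrow> v x0 j = 0"
    and S_0: "S 0 = {x0}"
    and S_subset: "S n \<subseteq> T"
    and S_finite: "finite (S n)"
    and S_card: "card (S (Suc n)) \<le> 2 ^ (2 ^ Suc n)"
    and proj: "t \<in> T \<Longrightarrow> \<pi> n t \<in> S n"
    and chain_le: "t \<in> T \<Longrightarrow> (\<Sum>n<N. 2 powr (real n / 2) * \<rho> (\<pi> n t) (\<pi> (Suc n) t)) \<le> G"
    and chain_tendsto: "t \<in> T \<Longrightarrow> (\<lambda>n. \<rho> (\<pi> n t) t) \<longlonglongrightarrow> 0"
    and F_nonneg: "0 \<le> F" and G_pos: "0 < G"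
begin

abbreviation "J \<equiv> {..<m} \<times> {..<B}"

definition link :: "(nat \<times> nat) set \<Rightarrow> 'x \<Rightarrow> 'x \<Rightarrow> 'x \<Rightarrow> (nat \<times> nat \<Rightarrow> real) \<Rightarrow> real" where
  "link I x y z \<sigma> = cross m B (\<lambda>j. v y j - v x j) (v z) (masked I \<sigma>) (masked (- I) \<sigma>)
     / (\<rho> x y * sqrt (energy m B (v z) (masked (- I) \<sigma>)))"

lemma proj_in: "t \<in> T \<Longrightarrow> \<pi> n t \<in> T"
  using proj S_subset by blast

text \<open>The factor 2 counts the two terms of a split increment. Level 0 needs its own case,
  since \<open>S_card\<close> speaks of positive levels while \<open>S 0\<close> is a
  singleton.\<close>

lemma card_links: "2 * card (S n \<times> S (Suc n)) \<le> 2 ^ (2 ^ (n + 2))"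
proof (cases n)
  case 0
  have "2 * card (S n \<times> S (Suc n)) \<le> 2 * 2 ^ (2 ^ Suc 0)"
    using 0 S_0 S_card[of 0] by (simp add: card_cartesian_product)
  then show ?thesis using 0 by simp
next
  case (Suc n')
  have "2 * card (S n \<times> S (Suc n)) \<le> 2 * (2 ^ (2 ^ n) * 2 ^ (2 ^ Suc n))"
    using S_card[of n'] S_card[of n] Suc
    by (simp only: card_cartesian_product) (intro mult_le_mono le_refl; simp)
  also have "\<dots> = 2 ^ (1 + 2 ^ n + 2 ^ Suc n)"
    by (simp only: power_add power_one_right mult.assoc)
  also have "\<dots> \<le> 2 ^ (2 ^ (n + 2))"
    by (intro power_increasing) auto
  finally show ?thesis .
qed

lemma cross_le:
  assumes "x \<in> T" "y \<in> T" and "\<bar>link I x y z \<sigma>\<bar> \<le> u"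
    and "energy m B (v z) (masked (- I) \<sigma>) \<le> Y\<^sup>2" "0 \<le> Y"
  shows "\<bar>cross m B (\<lambda>j. v y j - v x j) (v z) (masked I \<sigma>) (masked (- I) \<sigma>)\<bar> \<le> u * \<rho> x y * Y"
proof -
  define s where "s = \<rho> x y * sqrt (energy m B (v z) (masked (- I) \<sigma>))"
  define c where "c = cross m B (\<lambda>j. v y j - v x j) (v z) (masked I \<sigma>) (masked (- I) \<sigma>)"
  have s: "0 \<le> s" "s \<le> \<rho> x y * Y"
    using assms(4,5) energy_nonneg[of m B "v z" "masked (- I) \<sigma>"] dist_nonneg[of x y]
    by (auto simp: s_def intro!: mult_nonneg_nonneg mult_left_mono real_le_lsqrt)
  have "c = 0" if "s = 0"
    unfolding c_def using lipschitz[OF assms(1,2)] that by (intro cross_eq_0[of _ _ _ "\<rho> x y"]) (auto simp: s_def)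
  moreover have "\<bar>c / s\<bar> \<le> u"
    using assms(3) by (simp add: link_def c_def s_def)
  ultimately have "\<bar>c\<bar> \<le> u * s"
    using s by (cases "s = 0") (auto simp: field_simps)
  also have "\<dots> \<le> u * (\<rho> x y * Y)"
    using s assms(3) by (intro mult_left_mono) auto
  finally show ?thesis
    by (simp add: c_def mult.assoc)
qed

text \<open>\<open>U\<close> is chosen before \<open>t\<close> and \<open>Y\<close>, and
  \<open>Y\<close> may vary with the sign pattern. A random bound for the masked energies can
  therefore be inserted afterwards.\<close>

lemma chaos_bound:
  obtains U where "\<And>\<sigma>. 0 \<le> U \<sigma>" "avg (signs J) (\<lambda>\<sigma>. (U \<sigma>)\<^sup>2) \<le> 136"
    "\<And>\<sigma> t Y. \<lbrakk>\<sigma> \<in> signs J; t \<in> T; 0 \<le> Y; \<And>x. x \<in> T \<Longrightarrow> energy m B (v x) (masked I \<sigma>) \<le> Y\<^sup>2;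
        \<And>x. x \<in> T \<Longrightarrow> energy m B (v x) (masked (- I) \<sigma>) \<le> Y\<^sup>2\<rbrakk>
      \<Longrightarrow> \<bar>cross m B (v t) (v t) (masked I \<sigma>) (masked (- I) \<sigma>)\<bar> \<le> 2 * G * U \<sigma> * Y"
proof -
  \<comment> \<open>The two summands of \<open>cross_self_diff\<close>: the increment against the
    new endpoint \<open>y\<close> under \<open>I\<close>, and against the old endpoint
    \<open>x\<close> under the complement.\<close>
  define Fam where "Fam n = (\<lambda>(x, y). link I x y y) ` (S n \<times> S (Suc n))
    \<union> (\<lambda>(x, y). link (- I) x y x) ` (S n \<times> S (Suc n))" for n
  obtain U where U: "\<And>\<sigma>. 0 \<le> U \<sigma>" "avg (signs J) (\<lambda>\<sigma>. (U \<sigma>)\<^sup>2) \<le> 136"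
    "\<And>n f \<sigma>. f \<in> Fam n \<Longrightarrow> \<sigma> \<in> signs J \<Longrightarrow> \<bar>f \<sigma>\<bar> \<le> 2 powr (real n / 2) * U \<sigma>"
  proof (rule subgaussian_families_bound[of "signs J" Fam])
    show "finite (signs J)" "signs J \<noteq> {}"
      by (simp_all add: finite_signs signs_nonempty)
    show "finite (Fam n)" for n
      by (simp add: Fam_def S_finite)
    show "card (Fam n) \<le> 2 ^ 2 ^ (n + 2)" for n
    proof -
      have fin: "finite (S n \<times> S (Suc n))" by (simp add: S_finite)
      show ?thesis
        unfolding Fam_def
        using card_Un_le[of "(\<lambda>(x, y). link I x y y) ` (S n \<times> S (Suc n))" "(\<lambda>(x, y). link (- I) x y x) ` (S n \<times> S (Suc n))"]
          card_image_le[OF fin, of "\<lambda>(x, y). link I x y y"]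
          card_image_le[OF fin, of "\<lambda>(x, y). link (- I) x y x"] card_links[of n]
        by linarith
    qed
    show "avg (signs J) (\<lambda>\<sigma>. exp (l * f \<sigma>)) \<le> exp (l\<^sup>2 / 2)" if f: "f \<in> Fam n" for n f l
    proof -
      obtain I' x y z where "f = link I' x y z" "x \<in> T" "y \<in> T"
      proof -
        from f obtain x y where xy: "x \<in> S n" "y \<in> S (Suc n)"
          "f = link I x y y \<or> f = link (- I) x y x"
          unfolding Fam_def by auto
        then have "x \<in> T" "y \<in> T"
          using S_subset by auto
        with xy(3) show thesis
          using that by blast
      qed
      then show ?thesis
        using avg_exp_cross_le[OF lipschitz[of x y]] by (simp only: link_def)
    qed
  qed blast
  show thesis
  proof (rule that[OF U(1,2)])
    fix \<sigma> t Y assume \<sigma>: "\<sigma> \<in> signs J" and t: "t \<in> T" and Y: "0 \<le> Y"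
      "\<And>x. x \<in> T \<Longrightarrow> energy m B (v x) (masked I \<sigma>) \<le> Y\<^sup>2"
      "\<And>x. x \<in> T \<Longrightarrow> energy m B (v x) (masked (- I) \<sigma>) \<le> Y\<^sup>2"
    define H where "H x = cross m B (v x) (v x) (masked I \<sigma>) (masked (- I) \<sigma>)" for x
    have step: "\<bar>H (\<pi> (Suc n) t) - H (\<pi> n t)\<bar>
        \<le> 2 powr (real n / 2) * \<rho> (\<pi> n t) (\<pi> (Suc n) t) * (2 * U \<sigma> * Y)" for n
    proof -
      let ?x = "\<pi> n t" and ?y = "\<pi> (Suc n) t"
      have xy: "?x \<in> T" "?y \<in> T" "(?x, ?y) \<in> S n \<times> S (Suc n)"
        using proj[OF t] proj_in[OF t] by auto
      have "link I ?x ?y ?y \<in> Fam n" "link (- I) ?x ?y ?x \<in> Fam n"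
        using xy(3) by (force simp: Fam_def)+
      then have "\<bar>cross m B (\<lambda>j. v ?y j - v ?x j) (v ?y) (masked I \<sigma>) (masked (- I) \<sigma>)\<bar>
          \<le> (2 powr (real n / 2) * U \<sigma>) * \<rho> ?x ?y * Y"
        "\<bar>cross m B (\<lambda>j. v ?y j - v ?x j) (v ?x) (masked (- I) \<sigma>) (masked (- (- I)) \<sigma>)\<bar>
          \<le> (2 powr (real n / 2) * U \<sigma>) * \<rho> ?x ?y * Y"
        using U(3)[OF _ \<sigma>] xy Y by (intro cross_le; simp)+
      then show ?thesis
        unfolding H_def cross_self_diff by (simp add: algebra_simps)
    qed
    have "H x0 = 0"
      unfolding H_def cross_def block_sum_def using base by (auto intro!: sum.neutral)
    moreover have "\<pi> 0 t = x0"
      using proj[OF t, of 0] S_0 by simp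
    ultimately have tele: "H (\<pi> N t) = (\<Sum>n<N. H (\<pi> (Suc n) t) - H (\<pi> n t))" for N
      using sum_lessThan_telescope[of "\<lambda>n. H (\<pi> n t)" N] by simp
    have "\<bar>H (\<pi> N t)\<bar> \<le> (\<Sum>n<N. 2 powr (real n / 2) * \<rho> (\<pi> n t) (\<pi> (Suc n) t) * (2 * U \<sigma> * Y))" for N
      unfolding tele[of N] by (intro order_trans[OF sum_abs] sum_mono step)
    moreover have "(\<Sum>n<N. 2 powr (real n / 2) * \<rho> (\<pi> n t) (\<pi> (Suc n) t) * (2 * U \<sigma> * Y)) \<le> G * (2 * U \<sigma> * Y)" for N
      unfolding sum_distrib_right[symmetric]
      using U(1)[of \<sigma>] Y(1) by (intro mult_right_mono chain_le t) auto
    ultimately have bound: "\<bar>H (\<pi> N t)\<bar> \<le> G * (2 * U \<sigma> * Y)" for N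
      by (rule order_trans)
    \<comment> \<open>\<open>T\<close> may be infinite, so a chain need not reach \<open>t\<close>
      at a finite level. The coordinates converge by the Lipschitz condition, and the cross term is
      a finite continuous expression in them.\<close>
    have v_tendsto: "(\<lambda>n. v (\<pi> n t) (b, i)) \<longlonglongrightarrow> v t (b, i)" if "b < m" "i < B" for b i
    proof -
      have "cmod (v (\<pi> n t) (b, i) - v t (b, i)) \<le> \<rho> (\<pi> n t) t" for n
      proof -
        have "(cmod (v t (b, i) - v (\<pi> n t) (b, i)))\<^sup>2 \<le> (\<Sum>i<B. (cmod (v t (b, i) - v (\<pi> n t) (b, i)))\<^sup>2)"
          using that by (intro member_le_sum) auto
        also have "\<dots> \<le> (\<rho> (\<pi> n t) t)\<^sup>2"
          by (rule lipschitz[OF proj_in[OF t] t that(1)])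
        finally show ?thesis
          using dist_nonneg by (simp add: norm_minus_commute power2_le_iff_abs_le)
      qed
      then show ?thesis
        by (intro Lim_null_comparison[OF _ chain_tendsto[OF t], THEN LIM_zero_cancel]) auto
    qed
    have "(\<lambda>n. block_sum B (v (\<pi> n t)) s b) \<longlonglongrightarrow> block_sum B (v t) s b" if "b < m" for s b
      unfolding block_sum_def by (intro tendsto_intros v_tendsto that) auto
    then have "(\<lambda>n. H (\<pi> n t)) \<longlonglongrightarrow> H t"
      unfolding H_def cross_def by (intro tendsto_intros) auto
    then have "\<bar>H t\<bar> \<le> G * (2 * U \<sigma> * Y)"
      by (intro tendsto_upperbound[OF tendsto_rabs]) (auto simp: bound)
    then show "\<bar>cross m B (v t) (v t) (masked I \<sigma>) (masked (- I) \<sigma>)\<bar> \<le> 2 * G * U \<sigma> * Y"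
      by (simp add: H_def mult_ac)
  qed
qed

lemma chaos_le_sup:
  assumes "\<sigma> \<in> signs J" "t \<in> T"
  shows "\<bar>chaos m B (v t) \<sigma>\<bar> \<le> sup_chaos m B v T \<sigma>"
  using assms frob by (rule abs_chaos_le_sup_chaos)

lemma sup_chaos_nonneg: "\<sigma> \<in> signs J \<Longrightarrow> 0 \<le> sup_chaos m B v T \<sigma>"
  using chaos_le_sup[OF _ base(1)] abs_ge_zero order_trans by blast

lemma chaos_eq_avg:
  assumes "\<sigma> \<in> signs J"
  shows "chaos m B (v t) \<sigma> = avg (signs J) (\<lambda>\<tau>. energy m B (v t) \<sigma> - energy m B (v t) (\<lambda>j. \<tau> j * \<sigma> j))"
proof -
  have "avg (signs J) (\<lambda>\<tau>. energy m B (v t) \<sigma> - energy m B (v t) (\<lambda>j. \<tau> j * \<sigma> j))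
      = avg (signs J) (\<lambda>\<tau>. energy m B (v t) \<sigma>) - avg (signs J) (\<lambda>\<tau>. energy m B (v t) (\<lambda>j. \<tau> j * \<sigma> j))"
    by (simp add: avg_def sum_subtractf diff_divide_distrib)
  then show ?thesis
    by (simp add: chaos_def avg_const finite_signs signs_nonempty avg_energy avg_signs_mult_right[OF assms])
qed

lemma avg_sup_chaos_le: "avg (signs J) (sup_chaos m B v T) \<le> 8705 * (F * G + G\<^sup>2)"
proof -
  have "\<exists>U. (\<forall>\<sigma>. 0 \<le> U \<sigma>) \<and> avg (signs J) (\<lambda>\<sigma>. (U \<sigma>)\<^sup>2) \<le> 136 \<and>
    (\<forall>\<sigma> t Y. \<sigma> \<in> signs J \<longrightarrow> t \<in> T \<longrightarrow> 0 \<le> Y \<longrightarrow> (\<forall>x\<in>T. energy m B (v x) (masked I \<sigma>) \<le> Y\<^sup>2) \<longrightarrow>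
        (\<forall>x\<in>T. energy m B (v x) (masked (- I) \<sigma>) \<le> Y\<^sup>2)
      \<longrightarrow> \<bar>cross m B (v t) (v t) (masked I \<sigma>) (masked (- I) \<sigma>)\<bar> \<le> 2 * G * U \<sigma> * Y)" for I
    by (rule chaos_bound[of I]) blast
  then obtain U where U: "\<And>I \<sigma>. 0 \<le> U I \<sigma>" "\<And>I. avg (signs J) (\<lambda>\<sigma>. (U I \<sigma>)\<^sup>2) \<le> 136"
    "\<And>I \<sigma> t Y. \<lbrakk>\<sigma> \<in> signs J; t \<in> T; 0 \<le> Y; \<And>x. x \<in> T \<Longrightarrow> energy m B (v x) (masked I \<sigma>) \<le> Y\<^sup>2;
        \<And>x. x \<in> T \<Longrightarrow> energy m B (v x) (masked (- I) \<sigma>) \<le> Y\<^sup>2\<rbrakk>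
      \<Longrightarrow> \<bar>cross m B (v t) (v t) (masked I \<sigma>) (masked (- I) \<sigma>)\<bar> \<le> 2 * G * U I \<sigma> * Y"
    by metis
  define W where "W = avg (signs J) (sup_chaos m B v T)"
  \<comment> \<open>The weight must be small for absorption, but costs
    \<open>G\<^sup>2 / \<epsilon>\<close> when small and \<open>\<epsilon> * F\<^sup>2\<close> when
    large. This choice keeps both of order \<open>F * G + G\<^sup>2\<close> and is at most 1/2, so
    at most half of \<open>W\<close> returns.\<close>
  define \<epsilon> where "\<epsilon> = G / (2 * (F + G))"
  have FG: "0 < F + G" using F_nonneg G_pos by simp
  have \<epsilon>: "0 < \<epsilon>" "\<epsilon> \<le> 1 / 2"
    using FG F_nonneg G_pos by (auto simp: \<epsilon>_def field_simps)
  define Q where "Q \<tau> \<sigma> = F\<^sup>2 + (sup_chaos m B v T \<sigma> + sup_chaos m B v T (\<lambda>j. \<tau> j * \<sigma> j)) / 2" for \<tau> \<sigma>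
  define R where "R \<tau> \<sigma> = \<epsilon> * Q \<tau> \<sigma> + 16 * G\<^sup>2 / \<epsilon> * (U {j. \<tau> j = 1} \<sigma>)\<^sup>2" for \<tau> \<sigma>
  have diff_le: "\<bar>energy m B (v t) \<sigma> - energy m B (v t) (\<lambda>j. \<tau> j * \<sigma> j)\<bar> \<le> R \<tau> \<sigma>"
    if \<sigma>: "\<sigma> \<in> signs J" and \<tau>: "\<tau> \<in> signs J" and t: "t \<in> T" for \<sigma> \<tau> t
  proof -
    let ?I = "{j. \<tau> j = 1}"
    have Q_nonneg: "0 \<le> Q \<tau> \<sigma>"
      using sup_chaos_nonneg[OF \<sigma>] sup_chaos_nonneg[OF signs_mult[OF \<sigma> \<tau>]] by (simp add: Q_def)
    have energy_le': "energy m B (v x) s \<le> F\<^sup>2 + sup_chaos m B v T s" if "x \<in> T" "s \<in> signs J" for x s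
      using chaos_le_sup[OF that(2,1)] frob[OF that(1)] unfolding chaos_def by linarith
    have mean_le: "(energy m B (v x) \<sigma> + energy m B (v x) (\<lambda>j. \<tau> j * \<sigma> j)) / 2 \<le> Q \<tau> \<sigma>" if "x \<in> T" for x
      using energy_le'[OF that \<sigma>] energy_le'[OF that signs_mult[OF \<sigma> \<tau>]]
      unfolding Q_def by argo
    have "\<bar>cross m B (v t) (v t) (masked ?I \<sigma>) (masked (- ?I) \<sigma>)\<bar> \<le> 2 * G * U ?I \<sigma> * sqrt (Q \<tau> \<sigma>)"
    proof (rule U(3)[OF \<sigma> t])
      fix x assume x: "x \<in> T"
      show "energy m B (v x) (masked ?I \<sigma>) \<le> (sqrt (Q \<tau> \<sigma>))\<^sup>2"
        using order_trans[OF energy_masked_le(1)[OF \<tau>] mean_le[OF x]] Q_nonneg by simp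
      show "energy m B (v x) (masked (- ?I) \<sigma>) \<le> (sqrt (Q \<tau> \<sigma>))\<^sup>2"
        using order_trans[OF energy_masked_le(2)[OF \<tau>] mean_le[OF x]] Q_nonneg by simp
    qed (simp add: Q_nonneg)
    \<comment> \<open>The 8 is 4 from polarization times 2 from the two terms of each
      increment.\<close>
    then have "\<bar>energy m B (v t) \<sigma> - energy m B (v t) (\<lambda>j. \<tau> j * \<sigma> j)\<bar> \<le> 8 * G * U ?I \<sigma> * sqrt (Q \<tau> \<sigma>)"
      unfolding energy_diff[OF \<tau>] by simp
    also have "\<dots> \<le> R \<tau> \<sigma>"
    proof -
      have "0 \<le> (sqrt \<epsilon> * sqrt (Q \<tau> \<sigma>) - 4 * G * U ?I \<sigma> / sqrt \<epsilon>)\<^sup>2"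
        by simp
      also have "\<dots> = R \<tau> \<sigma> - 8 * G * U ?I \<sigma> * sqrt (Q \<tau> \<sigma>)"
        using \<epsilon>(1) Q_nonneg
        by (simp add: R_def power2_diff power_mult_distrib power_divide)
      finally show ?thesis by simp
    qed
    finally show ?thesis .
  qed
  have "sup_chaos m B v T \<sigma> \<le> avg (signs J) (\<lambda>\<tau>. R \<tau> \<sigma>)" if \<sigma>: "\<sigma> \<in> signs J" for \<sigma>
    unfolding sup_chaos_def
  proof (rule cSUP_least)
    fix t assume t: "t \<in> T"
    show "\<bar>chaos m B (v t) \<sigma>\<bar> \<le> avg (signs J) (\<lambda>\<tau>. R \<tau> \<sigma>)"
      unfolding chaos_eq_avg[OF \<sigma>]
      by (intro order_trans[OF abs_avg_le] avg_mono diff_le \<sigma> t)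
  qed (use base in auto)
  then have "W \<le> avg (signs J) (\<lambda>\<sigma>. avg (signs J) (\<lambda>\<tau>. R \<tau> \<sigma>))"
    unfolding W_def by (rule avg_mono)
  \<comment> \<open>The mask has to be fixed first, because the moment bound for \<open>U\<close>
    holds for each mask separately.\<close>
  also have "\<dots> = avg (signs J) (\<lambda>\<tau>. avg (signs J) (R \<tau>))"
    by (rule avg_swap)
  also have "\<dots> \<le> avg (signs J) (\<lambda>\<tau>. \<epsilon> * (F\<^sup>2 + W) + 16 * G\<^sup>2 / \<epsilon> * 136)"
  proof (rule avg_mono)
    fix \<tau> assume \<tau>: "\<tau> \<in> signs J"
    have "avg (signs J) (Q \<tau>) = F\<^sup>2 + (W + W) / 2"
      unfolding Q_def add_divide_distrib W_def
      using avg_cmult[of "signs J" "1 / 2" "sup_chaos m B v T"] avg_cmult[of "signs J" "1 / 2" "\<lambda>\<sigma>. sup_chaos m B v T (\<lambda>j. \<tau> j * \<sigma> j)"]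
        avg_signs_mult[OF \<tau>, of "sup_chaos m B v T"]
      by (simp add: avg_add avg_const finite_signs signs_nonempty)
    then have "avg (signs J) (R \<tau>) = \<epsilon> * (F\<^sup>2 + W) + 16 * G\<^sup>2 / \<epsilon> * avg (signs J) (\<lambda>\<sigma>. (U {j. \<tau> j = 1} \<sigma>)\<^sup>2)"
      unfolding R_def avg_add avg_cmult by simp
    also have "\<dots> \<le> \<epsilon> * (F\<^sup>2 + W) + 16 * G\<^sup>2 / \<epsilon> * 136"
      using \<epsilon>(1) by (intro add_left_mono mult_left_mono U) auto
    finally show "avg (signs J) (R \<tau>) \<le> \<epsilon> * (F\<^sup>2 + W) + 16 * G\<^sup>2 / \<epsilon> * 136" .
  qed
  also have "\<dots> = \<epsilon> * F\<^sup>2 + \<epsilon> * W + 4352 * (F * G + G\<^sup>2)"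
  proof -
    have "G\<^sup>2 / \<epsilon> = 2 * (F * G + G\<^sup>2)"
      using G_pos by (simp add: \<epsilon>_def power2_eq_square field_simps)
    then have "16 * G\<^sup>2 / \<epsilon> * 136 = 4352 * (F * G + G\<^sup>2)"
      by (simp add: times_divide_eq_right[symmetric] del: times_divide_eq_right)
    then show ?thesis
      by (simp add: avg_const finite_signs signs_nonempty distrib_left)
  qed
  also have "\<dots> \<le> F * G / 2 + W / 2 + 4352 * (F * G + G\<^sup>2)"
  proof -
    have "\<epsilon> * F\<^sup>2 \<le> F * G / 2"
    proof -
      have "\<epsilon> * F \<le> G / 2"
        using FG F_nonneg G_pos by (simp add: \<epsilon>_def field_simps)
      from mult_right_mono[OF this F_nonneg] show ?thesis
        by (simp add: power2_eq_square mult_ac)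
    qed
    moreover have "0 \<le> W"
      unfolding W_def avg_def by (intro divide_nonneg_nonneg sum_nonneg sup_chaos_nonneg) auto
    then have "\<epsilon> * W \<le> 1 / 2 * W"
      using \<epsilon>(2) by (rule mult_right_mono[rotated])
    ultimately show ?thesis by simp
  qed
  \<comment> \<open>Moving \<open>W / 2\<close> to the left doubles the rest:
    \<open>2 * (4352 + 1 / 2) = 8705\<close>, where \<open>4352 = 16 * 136 * 2\<close>.\<close>
  finally have "W \<le> 8705 * (F * G) + 8704 * G\<^sup>2"
    by simp
  then show ?thesis
    unfolding W_def by (simp add: algebra_simps) (smt (verit) zero_le_power2)
qed

end

subsection \<open>Lower integrals\<close>

text \<open>\<open>nn_integral\<close> is a supremum over finite simple minorants, whether or not
  \<open>f\<close> is measurable.\<close>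

lemma nn_integral_leI:
  assumes "\<And>g. \<lbrakk>g \<in> borel_measurable M; g \<le> f; \<And>x. g x < \<top>\<rbrakk> \<Longrightarrow> (\<integral>\<^sup>+ x. g x \<partial>M) \<le> K"
  shows "(\<integral>\<^sup>+ x. f x \<partial>M) \<le> K"
  unfolding nn_integral_def_finite
proof (rule SUP_least)
  fix g assume "g \<in> {g. simple_function M g \<and> g \<le> f \<and> (\<forall>x. g x < \<top>)}"
  then have "simple_function M g" "(\<integral>\<^sup>+ x. g x \<partial>M) \<le> K"
    by (auto intro!: assms borel_measurable_simple_function)
  then show "integral\<^sup>S M g \<le> K"
    by (simp add: nn_integral_eq_simple_integral)
qed

text \<open>Sections of a measurable minorant are minorants of the sections, so this half of Fubini
  survives for arbitrary \<open>f\<close>.\<close>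

lemma (in sigma_finite_measure) nn_integral_pair_le:
  "(\<integral>\<^sup>+ z. f z \<partial>(N \<Otimes>\<^sub>M M)) \<le> (\<integral>\<^sup>+ x. (\<integral>\<^sup>+ y. f (x, y) \<partial>M) \<partial>N)"
proof (rule nn_integral_leI)
  fix g assume g: "g \<in> borel_measurable (N \<Otimes>\<^sub>M M)" "g \<le> f"
  have "(\<integral>\<^sup>+ z. g z \<partial>(N \<Otimes>\<^sub>M M)) = (\<integral>\<^sup>+ x. (\<integral>\<^sup>+ y. g (x, y) \<partial>M) \<partial>N)"
    by (rule nn_integral_fst[OF g(1), symmetric])
  also have "\<dots> \<le> (\<integral>\<^sup>+ x. (\<integral>\<^sup>+ y. f (x, y) \<partial>M) \<partial>N)"
    using g(2) by (intro nn_integral_mono) (auto simp: le_fun_def)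
  finally show "(\<integral>\<^sup>+ z. g z \<partial>(N \<Otimes>\<^sub>M M)) \<le> (\<integral>\<^sup>+ x. (\<integral>\<^sup>+ y. f (x, y) \<partial>M) \<partial>N)" .
qed

text \<open>The function \<open>h\<close> need not be measurable, and lower integrals are not subadditive. But whether
  \<open>F * h\<close> or \<open>h\<^sup>2\<close> dominates a measurable minorant \<open>w\<close> of their maximum is decided by the measurable
  condition \<open>w \<le> F\<^sup>2\<close>.\<close>

lemma nn_integral_quadratic_le:
  fixes f F h v :: "'a \<Rightarrow> ennreal" and c :: real
  assumes F: "F \<in> borel_measurable M" and v: "v \<in> borel_measurable M" and c: "0 < c"
    and le: "\<And>x. x \<in> space M \<Longrightarrow> f x \<le> ennreal c * (F x * h x + (h x)\<^sup>2) + v x"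
  shows "(\<integral>\<^sup>+ x. f x \<partial>M)
    \<le> ennreal (2 * c) * ((\<integral>\<^sup>+ x. F x * h x \<partial>M) + (\<integral>\<^sup>+ x. (h x)\<^sup>2 \<partial>M)) + (\<integral>\<^sup>+ x. v x \<partial>M)"
proof (rule nn_integral_leI)
  fix g assume g[measurable]: "g \<in> borel_measurable M" and gf: "g \<le> f" and g_fin: "\<And>x. g x < \<top>"
  note [measurable] = F v
  \<comment> \<open>The 2 comes from bounding the sum \<open>F x * h x + (h x)\<^sup>2\<close> by
    twice its larger term. Finiteness of \<open>g\<close> excludes a difference of two
    infinities.\<close>
  define w where "w x = ennreal (1 / (2 * c)) * (g x - v x)" for x
  define h1 where "h1 x = (if w x \<le> (F x)\<^sup>2 then w x else 0)" for x
  define h2 where "h2 x = (if w x \<le> (F x)\<^sup>2 then 0 else w x)" for x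
  have w_meas[measurable]: "w \<in> borel_measurable M"
    unfolding w_def by measurable
  have [measurable]: "h1 \<in> borel_measurable M" "h2 \<in> borel_measurable M"
    unfolding h1_def h2_def by measurable
  have inv: "ennreal (1 / (2 * c)) * (ennreal (2 * c) * y) = y" "ennreal (2 * c) * (ennreal (1 / (2 * c)) * y) = y" for y
    using c by (simp_all add: mult.assoc[symmetric] ennreal_mult[symmetric] del: ennreal_mult)
  have w_le: "w x \<le> max (F x * h x) ((h x)\<^sup>2)" if "x \<in> space M" for x
  proof -
    let ?m = "max (F x * h x) ((h x)\<^sup>2)"
    have "g x \<le> v x + ennreal c * (F x * h x + (h x)\<^sup>2)"
      using gf le[OF that] by (auto simp: le_fun_def add.commute intro: order_trans)
    then have "g x - v x \<le> ennreal c * (F x * h x + (h x)\<^sup>2)"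
      using g_fin[of x] by (subst ennreal_minus_le_iff) auto
    also have "\<dots> \<le> ennreal c * (?m + ?m)"
      by (intro mult_left_mono add_mono) auto
    also have "\<dots> = ennreal (2 * c) * ?m"
      using c by (simp add: ennreal_mult mult_2[symmetric] mult_ac)
    finally have "w x \<le> ennreal (1 / (2 * c)) * (ennreal (2 * c) * ?m)"
      unfolding w_def by (rule mult_left_mono) simp
    then show ?thesis by (simp only: inv)
  qed
  have h1_le: "h1 x \<le> F x * h x" if "x \<in> space M" for x
  proof (cases "h x \<le> F x")
    case True
    then have "(h x)\<^sup>2 \<le> F x * h x"
      unfolding power2_eq_square by (rule mult_right_mono) simp
    then show ?thesis
      using w_le[OF that] by (auto simp: h1_def max_def split: if_splits)
  next
    case False
    then have "(F x)\<^sup>2 \<le> F x * h x"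
      unfolding power2_eq_square by (intro mult_left_mono) auto
    then show ?thesis
      by (auto simp: h1_def)
  qed
  have h2_le: "h2 x \<le> (h x)\<^sup>2" if "x \<in> space M" for x
  proof (cases "h x \<le> F x")
    case True
    then have "(h x)\<^sup>2 \<le> (F x)\<^sup>2" "F x * h x \<le> (F x)\<^sup>2"
      unfolding power2_eq_square by (auto intro: mult_mono mult_left_mono)
    then have "w x \<le> (F x)\<^sup>2"
      using w_le[OF that] by (meson max.boundedI order_trans)
    then show ?thesis by (simp add: h2_def)
  next
    case False
    then have "F x * h x \<le> (h x)\<^sup>2"
      unfolding power2_eq_square by (intro mult_right_mono) auto
    then show ?thesis
      using w_le[OF that] by (auto simp: h2_def max_def split: if_splits)
  qed
  have "g x \<le> ennreal (2 * c) * (h1 x + h2 x) + v x" for x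
  proof -
    have "g x \<le> (g x - v x) + v x"
      by (metis add.commute ennreal_minus_le_iff order_refl g_fin less_irrefl)
    also have "g x - v x = ennreal (2 * c) * w x"
      unfolding w_def by (simp only: inv)
    also have "w x = h1 x + h2 x"
      by (simp add: h1_def h2_def)
    finally show ?thesis .
  qed
  then have "(\<integral>\<^sup>+ x. g x \<partial>M) \<le> (\<integral>\<^sup>+ x. ennreal (2 * c) * (h1 x + h2 x) + v x \<partial>M)"
    by (intro nn_integral_mono)
  also have "\<dots> = ennreal (2 * c) * ((\<integral>\<^sup>+ x. h1 x \<partial>M) + (\<integral>\<^sup>+ x. h2 x \<partial>M)) + (\<integral>\<^sup>+ x. v x \<partial>M)"
    by (simp add: nn_integral_add nn_integral_cmult)
  also have "\<dots> \<le> ennreal (2 * c) * ((\<integral>\<^sup>+ x. F x * h x \<partial>M) + (\<integral>\<^sup>+ x. (h x)\<^sup>2 \<partial>M)) + (\<integral>\<^sup>+ x. v x \<partial>M)"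
    by (intro add_mono mult_left_mono nn_integral_mono h1_le h2_le) auto
  finally show "(\<integral>\<^sup>+ x. g x \<partial>M)
    \<le> ennreal (2 * c) * ((\<integral>\<^sup>+ x. F x * h x \<partial>M) + (\<integral>\<^sup>+ x. (h x)\<^sup>2 \<partial>M)) + (\<integral>\<^sup>+ x. v x \<partial>M)" .
qed

subsection \<open>Measurability of suprema over the sparse ball\<close>

text \<open>A supremum of continuous functions is lower semicontinuous: its superlevel sets are
  unions of open sets, however large \<open>I\<close> is. This avoids choosing a countable dense
  subset of the sparse ball.\<close>

lemma borel_measurable_SUP_continuous:
  fixes \<phi> :: "'i \<Rightarrow> 'a::topological_space \<Rightarrow> ennreal"
  assumes "\<And>i. i \<in> I \<Longrightarrow> continuous_on UNIV (\<phi> i)"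
  shows "(\<lambda>\<omega>. SUP i\<in>I. \<phi> i \<omega>) \<in> borel_measurable borel"
proof (rule borel_measurableI_greater)
  fix y
  have "{\<omega> \<in> space borel. y < (SUP i\<in>I. \<phi> i \<omega>)} = (\<Union>i\<in>I. {\<omega>. y < \<phi> i \<omega>})"
    by (auto simp: less_SUP_iff)
  moreover have "open \<dots>"
    using assms by (intro open_UN ballI open_Collect_less continuous_intros) auto
  ultimately show "{\<omega> \<in> space borel. y < (SUP i\<in>I. \<phi> i \<omega>)} \<in> sets borel"
    by simp
qed

text \<open>The entries are extended to all index pairs, constantly \<open>undefined\<close> outside
  the matrix, because the topology on the function type is the product over its whole countable
  domain, and there its Borel sets agree with the product \<sigma>-algebra.\<close>

lemma measurable_mat_entries:
  assumes "mat_distribution nr nc \<A>"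
  shows "(\<lambda>A. \<lambda>p\<in>{..<nr} \<times> {..<nc}. A $$ p) \<in> borel_measurable \<A>"
proof -
  let ?I = "{..<nr} \<times> {..<nc}"
  have "(\<lambda>A. \<lambda>p\<in>?I. A $$ p) \<in> measurable (mat_borel nr nc) (PiM ?I (\<lambda>_. borel))"
    unfolding mat_borel_def by (rule measurable_vimage_algebra1) (auto simp: space_PiM)
  then have meas: "(\<lambda>A. \<lambda>p\<in>?I. A $$ p) \<in> measurable \<A> (PiM ?I (\<lambda>_. borel))"
    using assms by (simp add: mat_distribution_def cong: measurable_cong_sets)
  have "(\<lambda>A. \<lambda>p\<in>?I. A $$ p) \<in> measurable \<A> (PiM UNIV (\<lambda>_. borel))"
  proof (rule measurable_PiM_single')
    fix p
    show "(\<lambda>A. (\<lambda>p\<in>?I. A $$ p) p) \<in> borel_measurable \<A>"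
    proof (cases "p \<in> ?I")
      case True
      from measurable_compose[OF meas measurable_component_singleton[OF True]] show ?thesis
        by simp
    next
      case False
      then have "(\<lambda>A. (\<lambda>p\<in>?I. A $$ p) p) = (\<lambda>_. undefined :: complex)"
        by (auto simp: restrict_def)
      then show ?thesis by simp
    qed
  qed auto
  then show ?thesis
    by (simp add: sets_PiM_equal_borel cong: measurable_cong_sets)
qed

lemma space_mat_distribution:
  assumes "mat_distribution nr nc \<A>"
  shows "space \<A> = carrier_mat nr nc"
  using assms sets_eq_imp_space_eq[of \<A> "mat_borel nr nc"]
  by (simp add: mat_distribution_def mat_borel_def)

lemma borel_measurable_mat_SUP:
  fixes \<phi> :: "'i \<Rightarrow> (nat \<times> nat \<Rightarrow> complex) \<Rightarrow> ennreal"
  assumes \<A>: "mat_distribution nr nc \<A>"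
    and cont: "\<And>i. i \<in> I \<Longrightarrow> continuous_on UNIV (\<phi> i)"
    and eq: "\<And>i A. i \<in> I \<Longrightarrow> A \<in> carrier_mat nr nc \<Longrightarrow> f i A = \<phi> i (\<lambda>p\<in>{..<nr} \<times> {..<nc}. A $$ p)"
  shows "(\<lambda>A. SUP i\<in>I. f i A) \<in> borel_measurable \<A>"
proof -
  have "(\<lambda>A. SUP i\<in>I. \<phi> i (\<lambda>p\<in>{..<nr} \<times> {..<nc}. A $$ p)) \<in> borel_measurable \<A>"
    by (rule measurable_compose[OF measurable_mat_entries[OF \<A>] borel_measurable_SUP_continuous[OF cont]])
  then show ?thesis
    using eq space_mat_distribution[OF \<A>] by (subst measurable_cong) (auto intro!: SUP_cong)
qed

section \<open>Norms of matrix images in terms of the entries\<close>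

lemma mult_mat_vec_nth:
  assumes "A \<in> carrier_mat nr nc" "x \<in> carrier_vec nc" "r < nr"
  shows "(A *\<^sub>v x) $ r = (\<Sum>c<nc. A $$ (r, c) * x $ c)"
  using assms by (auto simp: scalar_prod_def atLeast0LessThan)

lemma vnorm_square: "(vnorm x)\<^sup>2 = (\<Sum>i<dim_vec x. (cmod (x $ i))\<^sup>2)"
  unfolding vnorm_def L2_set_def by (simp add: sum_nonneg)

lemma vnorm_nonneg: "0 \<le> vnorm x"
  unfolding vnorm_def by simp

definition entry_energy :: "nat \<Rightarrow> nat \<Rightarrow> complex vec \<Rightarrow> (nat \<times> nat \<Rightarrow> complex) \<Rightarrow> real" where
  "entry_energy nr nc x \<omega> = (\<Sum>r<nr. (cmod (\<Sum>c<nc. \<omega> (r, c) * x $ c))\<^sup>2)"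

lemma continuous_entry_energy: "continuous_on UNIV (entry_energy nr nc x)"
  unfolding entry_energy_def by (intro continuous_intros continuous_on_product_coordinates)

lemma vnorm_mult_square:
  assumes "A \<in> carrier_mat nr nc" "x \<in> carrier_vec nc"
  shows "(vnorm (A *\<^sub>v x))\<^sup>2 = entry_energy nr nc x (\<lambda>p\<in>{..<nr} \<times> {..<nc}. A $$ p)"
  unfolding vnorm_square entry_energy_def
  using assms by (intro sum.cong) (auto simp: mult_mat_vec_nth simp del: index_mult_mat_vec)

lemma borel_measurable_isometry_defect:
  assumes "mat_distribution nr d \<A>"
  shows "isometry_defect d k N \<in> borel_measurable \<A>"
  unfolding isometry_defect_def
proof (rule borel_measurable_mat_SUP[OF assms])
  show "continuous_on UNIV (\<lambda>\<omega>. ennreal \<bar>1 / real N * entry_energy nr d x \<omega> - (vnorm x)\<^sup>2\<bar>)" for x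
    by (intro continuous_on_ennreal continuous_intros continuous_entry_energy)
qed (auto simp: sparse_ball_def vnorm_mult_square)

lemma borel_measurable_SUP_vnorm:
  assumes "mat_distribution nr d \<A>"
  shows "(\<lambda>A. SUP x\<in>sparse_ball d k. ennreal (vnorm (A *\<^sub>v x))) \<in> borel_measurable \<A>"
proof (rule borel_measurable_mat_SUP[OF assms])
  show "continuous_on UNIV (\<lambda>\<omega>. ennreal (sqrt (entry_energy nr d x \<omega>)))" for x
    by (intro continuous_on_ennreal continuous_intros continuous_entry_energy)
  show "ennreal (vnorm (A *\<^sub>v x)) = ennreal (sqrt (entry_energy nr d x (\<lambda>p\<in>{..<nr} \<times> {..<d}. A $$ p)))"
    if "x \<in> sparse_ball d k" "A \<in> carrier_mat nr d" for x A
    using that by (simp add: sparse_ball_def vnorm_mult_square[symmetric] vnorm_nonneg)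
qed

subsection \<open>Admissible sequences and the block norm\<close>

text \<open>The infimum over admissible sequences need not be attained, hence the strict inequality.
  The point \<open>\<pi> n t\<close> lies in member \<open>Suc n\<close>, the shift being that of
  the series.\<close>

lemma gamma2_lessE:
  assumes less: "gamma2 T \<rho> < ennreal g" and nonneg: "\<And>x y. 0 \<le> \<rho> x y" and T: "T \<noteq> {}"
  obtains S \<pi> where "admissible_seq T S" "\<And>n t. t \<in> T \<Longrightarrow> \<pi> n t \<in> S (Suc n)"
    "\<And>N t. t \<in> T \<Longrightarrow> (\<Sum>n<N. 2 powr (real (Suc n) / 2) * \<rho> (\<pi> n t) t) \<le> g"
proof -
  obtain S where S: "admissible_seq T S"
    and sup: "(SUP t\<in>T. \<Sum>n. ennreal (2 powr (real (Suc n) / 2)) * set_dist \<rho> (S (Suc n)) t) < ennreal g"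
    using less unfolding gamma2_def by (auto simp: INF_less_iff)
  have g: "0 \<le> g"
    using less by (cases "g \<ge> 0") (auto simp: ennreal_neg)
  have sum_less: "(\<Sum>n. ennreal (2 powr (real (Suc n) / 2)) * set_dist \<rho> (S (Suc n)) t) < ennreal g" if "t \<in> T" for t
    using sup SUP_upper[OF that] by (rule le_less_trans[rotated])
  have term_less: "ennreal (2 powr (real (Suc n) / 2)) * set_dist \<rho> (S (Suc n)) t < ennreal g" if "t \<in> T" for n t
    using sum_le_suminf[of "\<lambda>n. ennreal (2 powr (real (Suc n) / 2)) * set_dist \<rho> (S (Suc n)) t" "{n}"]
      sum_less[OF that] by (auto intro: le_less_trans)
  have "\<exists>a\<in>S (Suc n). set_dist \<rho> (S (Suc n)) t = ennreal (\<rho> a t)" if t: "t \<in> T" for n t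
  proof -
    \<comment> \<open>An empty member would be at infinite distance and make the series infinite. In
      a finite nonempty member the infimum is attained.\<close>
    have "S (Suc n) \<noteq> {}"
    proof
      assume "S (Suc n) = {}"
      then have "set_dist \<rho> (S (Suc n)) t = \<top>"
        by (simp add: set_dist_def)
      then show False
        using term_less[OF t, of n] by (simp add: ennreal_mult_top)
    qed
    moreover have "finite (S (Suc n))"
      using S by (simp add: admissible_seq_def)
    ultimately have "Inf ((\<lambda>a. ennreal (\<rho> a t)) ` S (Suc n)) \<in> (\<lambda>a. ennreal (\<rho> a t)) ` S (Suc n)"
      by (subst cInf_eq_Min) (auto intro!: Min_in)
    then show ?thesis
      unfolding set_dist_def by auto
  qed
  then have ex: "\<exists>a. a \<in> S (Suc n) \<and> set_dist \<rho> (S (Suc n)) t = ennreal (\<rho> a t)" if "t \<in> T" for n t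
    using that by blast
  define \<pi> where "\<pi> n t = (SOME a. a \<in> S (Suc n) \<and> set_dist \<rho> (S (Suc n)) t = ennreal (\<rho> a t))" for n t
  have \<pi>: "\<pi> n t \<in> S (Suc n)" "set_dist \<rho> (S (Suc n)) t = ennreal (\<rho> (\<pi> n t) t)" if "t \<in> T" for n t
    using someI_ex[OF ex[OF that, of n]] by (auto simp: \<pi>_def)
  show thesis
  proof (rule that[OF S \<pi>(1)])
    fix N t assume t: "t \<in> T"
    have "ennreal (\<Sum>n<N. 2 powr (real (Suc n) / 2) * \<rho> (\<pi> n t) t)
        = (\<Sum>n<N. ennreal (2 powr (real (Suc n) / 2)) * set_dist \<rho> (S (Suc n)) t)"
      by (subst sum_ennreal[symmetric]) (auto simp: nonneg \<pi>(2)[OF t] ennreal_mult)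
    also have "\<dots> \<le> (\<Sum>n. ennreal (2 powr (real (Suc n) / 2)) * set_dist \<rho> (S (Suc n)) t)"
      by (rule sum_le_suminf) auto
    also have "\<dots> \<le> ennreal g"
      using sum_less[OF t] by simp
    finally show "(\<Sum>n<N. 2 powr (real (Suc n) / 2) * \<rho> (\<pi> n t) t) \<le> g"
      using g by (simp add: ennreal_le_iff)
  qed
qed

section \<open>Closure properties of the sparse ball\<close>

lemma zero_in_sparse_ball: "0\<^sub>v d \<in> sparse_ball d k"
proof -
  have "card {j. j < d \<and> 0\<^sub>v d $ j \<noteq> (0::complex)} = 0"
    by (simp add: card_eq_0_iff)
  then show ?thesis
    unfolding sparse_ball_def by (simp only: mem_Collect_eq) (simp add: vnorm_def L2_set_def)
qed

lemma vnorm_smult: "vnorm (c \<cdot>\<^sub>v x) = cmod c * vnorm x"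
proof -
  have "vnorm (c \<cdot>\<^sub>v x) = L2_set (\<lambda>i. cmod c * cmod (x $ i)) {..<dim_vec x}"
    unfolding vnorm_def by (intro L2_set_cong) (auto simp: norm_mult)
  then show ?thesis
    by (simp add: vnorm_def L2_set_right_distrib)
qed

lemma smult_in_sparse_ball:
  assumes "x \<in> sparse_ball d k" "cmod c \<le> 1"
  shows "c \<cdot>\<^sub>v x \<in> sparse_ball d k"
proof -
  have x: "x \<in> carrier_vec d" "card {j. j < d \<and> x $ j \<noteq> 0} \<le> k" "vnorm x \<le> 1"
    using assms by (auto simp: sparse_ball_def)
  have "card {j. j < d \<and> (c \<cdot>\<^sub>v x) $ j \<noteq> 0} \<le> card {j. j < d \<and> x $ j \<noteq> 0}"
    using x(1) by (intro card_mono) auto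
  moreover have "cmod c * vnorm x \<le> 1"
    using assms(2) x(3) vnorm_nonneg[of x] by (metis mult_le_one norm_ge_zero)
  ultimately show ?thesis
    using x by (auto simp: sparse_ball_def vnorm_smult)
qed

section \<open>The image of a vector arranged in blocks, and the block norm\<close>

definition block_entries :: "nat \<Rightarrow> complex mat \<Rightarrow> complex vec \<Rightarrow> nat \<times> nat \<Rightarrow> complex" where
  "block_entries B A x = (\<lambda>(b, i). (A *\<^sub>v x) $ (B * b + i))"

lemma block_index_less: "b < m \<Longrightarrow> i < B \<Longrightarrow> B * b + i < m * (B::nat)"
proof -
  assume "b < m" "i < B"
  then have "B * b + i < B * Suc b" by simp
  also have "\<dots> \<le> B * m" using \<open>b < m\<close> by (intro mult_le_mono) auto
  finally show ?thesis by (simp add: mult.commute)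
qed

context
  fixes m B d :: nat and A :: "complex mat"
  assumes A: "A \<in> carrier_mat (m * B) d"
begin

lemma block_entries_eq:
  assumes "x \<in> carrier_vec d" "b < m" "i < B"
  shows "block_entries B A x (b, i) = (\<Sum>j<d. A $$ (B * b + i, j) * x $ j)"
  using mult_mat_vec_nth[OF A assms(1) block_index_less[OF assms(2,3)]] by (simp add: block_entries_def)

lemma block_entries_diff:
  assumes "x \<in> carrier_vec d" "y \<in> carrier_vec d" "b < m" "i < B"
  shows "block_entries B A (x - y) (b, i) = block_entries B A x (b, i) - block_entries B A y (b, i)"
  using assms by (simp add: block_entries_eq algebra_simps sum_subtractf)

lemma block_entries_smult:
  assumes "x \<in> carrier_vec d" "b < m" "i < B"
  shows "block_entries B A (c \<cdot>\<^sub>v x) (b, i) = c * block_entries B A x (b, i)"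
  using assms by (simp add: block_entries_eq sum_distrib_left mult_ac)

lemma vnorm_row_block:
  assumes "x \<in> carrier_vec d" "b < m"
  shows "vnorm (row_block B A b *\<^sub>v x) = L2_set (\<lambda>i. cmod (block_entries B A x (b, i))) {..<B}"
proof -
  have carrier: "row_block B A b \<in> carrier_mat B d"
    using A by (simp add: row_block_def)
  have "(row_block B A b *\<^sub>v x) $ i = block_entries B A x (b, i)" if "i < B" for i
    using A assms that
    by (simp only: mult_mat_vec_nth[OF carrier assms(1) that] block_entries_eq) (simp add: row_block_def)
  moreover have "dim_vec (row_block B A b *\<^sub>v x) = B"
    by (simp add: row_block_def)
  ultimately show ?thesis
    unfolding vnorm_def by (intro L2_set_cong) (auto simp del: index_mult_mat_vec)
qed

lemma sum_block_entries:
  "(\<Sum>j\<in>{..<m} \<times> {..<B}. (cmod (block_entries B A x j))\<^sup>2) = (vnorm (A *\<^sub>v x))\<^sup>2"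
proof -
  have "(\<Sum>j\<in>{..<m} \<times> {..<B}. (cmod (block_entries B A x j))\<^sup>2)
      = (\<Sum>b<m. \<Sum>i<B. (cmod ((A *\<^sub>v x) $ (i + b * B)))\<^sup>2)"
    by (simp add: sum.cartesian_product split_def block_entries_def mult.commute add.commute)
  also have "\<dots> = (\<Sum>b<m. \<Sum>i\<in>{b * B..<b * B + B}. (cmod ((A *\<^sub>v x) $ i))\<^sup>2)"
    using sum.shift_bounds_nat_ivl[of "\<lambda>i. (cmod ((A *\<^sub>v x) $ i))\<^sup>2" 0 "_ * B" B]
    by (simp add: atLeast0LessThan add.commute)
  also have "\<dots> = (\<Sum>i<m * B. (cmod ((A *\<^sub>v x) $ i))\<^sup>2)"
    by (rule sum.nat_group)
  finally show ?thesis
    using A by (simp add: vnorm_square)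
qed

lemma vnorm_signed_block_sum:
  assumes "x \<in> carrier_vec d"
  shows "(vnorm (signed_block_sum m B A \<sigma> *\<^sub>v x))\<^sup>2 = energy m B (block_entries B A x) \<sigma>"
proof -
  have carrier: "signed_block_sum m B A \<sigma> \<in> carrier_mat m d"
    using A by (simp add: signed_block_sum_def)
  have "(signed_block_sum m B A \<sigma> *\<^sub>v x) $ b = block_sum B (block_entries B A x) \<sigma> b" if b: "b < m" for b
  proof -
    have "(signed_block_sum m B A \<sigma> *\<^sub>v x) $ b
        = (\<Sum>j<d. (\<Sum>i<B. of_real (\<sigma> (b, i)) * A $$ (B * b + i, j)) * x $ j)"
      unfolding mult_mat_vec_nth[OF carrier assms b]
      using A b by (intro sum.cong) (auto simp: signed_block_sum_def)
    also have "\<dots> = (\<Sum>i<B. \<Sum>j<d. of_real (\<sigma> (b, i)) * (A $$ (B * b + i, j) * x $ j))"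
      by (subst sum.swap) (simp add: sum_distrib_right mult.assoc)
    also have "\<dots> = block_sum B (block_entries B A x) \<sigma> b"
      unfolding block_sum_def using assms b
      by (intro sum.cong refl) (simp add: block_entries_eq sum_distrib_left)
    finally show ?thesis .
  qed
  moreover have "dim_vec (signed_block_sum m B A \<sigma> *\<^sub>v x) = m"
    using carrier by simp
  ultimately show ?thesis
    unfolding vnorm_square energy_def by simp
qed

lemma vnorm_row_block_le:
  assumes "b < m"
  shows "vnorm (row_block B A b *\<^sub>v x) \<le> block_norm m B A x"
  unfolding block_norm_def using assms by (intro Max_ge) auto

lemma block_norm_attained:
  assumes "0 < m"
  obtains b where "b < m" "block_norm m B A x = vnorm (row_block B A b *\<^sub>v x)"
proof -
  have "block_norm m B A x \<in> (\<lambda>b. vnorm (row_block B A b *\<^sub>v x)) ` {..<m}"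
    unfolding block_norm_def using assms by (intro Max_in) auto
  then show thesis using that by auto
qed

lemma block_norm_nonneg: "0 < m \<Longrightarrow> 0 \<le> block_norm m B A x"
  by (rule block_norm_attained[of x]) (auto simp: vnorm_nonneg)

lemma block_norm_commute:
  assumes "x \<in> carrier_vec d" "y \<in> carrier_vec d"
  shows "block_norm m B A (x - y) = block_norm m B A (y - x)"
proof -
  have "vnorm (row_block B A b *\<^sub>v (x - y)) = vnorm (row_block B A b *\<^sub>v (y - x))" if "b < m" for b
    unfolding vnorm_row_block[OF minus_carrier_vec[OF assms] that]
      vnorm_row_block[OF minus_carrier_vec[OF assms(2,1)] that]
    using assms that by (intro L2_set_cong) (auto simp: block_entries_diff norm_minus_commute)
  then show ?thesis
    unfolding block_norm_def by (intro arg_cong[where f=Max] image_cong) auto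
qed

lemma block_norm_triangle:
  assumes "0 < m" "x \<in> carrier_vec d" "y \<in> carrier_vec d" "z \<in> carrier_vec d"
  shows "block_norm m B A (x - z) \<le> block_norm m B A (x - y) + block_norm m B A (y - z)"
proof -
  obtain b where b: "b < m" "block_norm m B A (x - z) = vnorm (row_block B A b *\<^sub>v (x - z))"
    using block_norm_attained[OF assms(1)] by metis
  let ?f = "\<lambda>x i. block_entries B A x (b, i)"
  have diff: "vnorm (row_block B A b *\<^sub>v (u - w)) = L2_set (\<lambda>i. cmod (?f u i - ?f w i)) {..<B}"
    if "u \<in> carrier_vec d" "w \<in> carrier_vec d" for u w
    unfolding vnorm_row_block[OF minus_carrier_vec[OF that] b(1)]
    using that b by (intro L2_set_cong) (auto simp: block_entries_diff)
  have "vnorm (row_block B A b *\<^sub>v (x - z)) = L2_set (\<lambda>i. cmod ((?f x i - ?f y i) + (?f y i - ?f z i))) {..<B}"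
    using assms by (simp add: diff)
  also have "\<dots> \<le> L2_set (\<lambda>i. cmod (?f x i - ?f y i) + cmod (?f y i - ?f z i)) {..<B}"
    by (intro L2_set_mono norm_triangle_ineq) auto
  also have "\<dots> \<le> L2_set (\<lambda>i. cmod (?f x i - ?f y i)) {..<B} + L2_set (\<lambda>i. cmod (?f y i - ?f z i)) {..<B}"
    by (rule L2_set_triangle_ineq)
  also have "\<dots> = vnorm (row_block B A b *\<^sub>v (x - y)) + vnorm (row_block B A b *\<^sub>v (y - z))"
    using assms by (simp add: diff)
  also have "\<dots> \<le> block_norm m B A (x - y) + block_norm m B A (y - z)"
    by (intro add_mono vnorm_row_block_le b)
  finally show ?thesis using b by simp
qed

lemma block_entries_lipschitz:
  assumes "x \<in> carrier_vec d" "y \<in> carrier_vec d" "b < m"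
  shows "(\<Sum>i<B. (cmod (block_entries B A y (b, i) - block_entries B A x (b, i)))\<^sup>2) \<le> (block_norm m B A (x - y))\<^sup>2"
proof -
  have "(\<Sum>i<B. (cmod (block_entries B A y (b, i) - block_entries B A x (b, i)))\<^sup>2)
      = (L2_set (\<lambda>i. cmod (block_entries B A (y - x) (b, i))) {..<B})\<^sup>2"
    using assms by (simp add: L2_set_def sum_nonneg block_entries_diff)
  also have "\<dots> = (vnorm (row_block B A b *\<^sub>v (y - x)))\<^sup>2"
    using assms by (simp add: vnorm_row_block)
  also have "\<dots> \<le> (block_norm m B A (y - x))\<^sup>2"
    by (intro power_mono vnorm_row_block_le assms vnorm_nonneg)
  finally show ?thesis
    using block_norm_commute[OF assms(1,2)] by simp
qed

lemma SUP_vnorm_finite: "(SUP x\<in>sparse_ball d k. ennreal (vnorm (A *\<^sub>v x))) < \<top>"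
proof -
  have "vnorm (A *\<^sub>v x) \<le> (\<Sum>r<m * B. \<Sum>c<d. cmod (A $$ (r, c)))" if "x \<in> sparse_ball d k" for x
  proof -
    have x: "x \<in> carrier_vec d" "vnorm x \<le> 1" using that by (auto simp: sparse_ball_def)
    have x_le: "cmod (x $ c) \<le> 1" if "c < d" for c
      using member_le_L2_set[of "{..<dim_vec x}" c "\<lambda>i. cmod (x $ i)"] x that by (auto simp: vnorm_def)
    have "vnorm (A *\<^sub>v x) \<le> (\<Sum>r<m * B. cmod ((A *\<^sub>v x) $ r))"
      unfolding vnorm_def using A by (intro order_trans[OF L2_set_le_sum]) (auto simp del: index_mult_mat_vec)
    also have "\<dots> \<le> (\<Sum>r<m * B. \<Sum>c<d. cmod (A $$ (r, c)))"
    proof (rule sum_mono)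
      fix r assume "r \<in> {..<m * B}"
      then have "cmod ((A *\<^sub>v x) $ r) \<le> (\<Sum>c<d. cmod (A $$ (r, c)) * cmod (x $ c))"
        using mult_mat_vec_nth[OF A x(1)] by (auto simp: norm_mult simp del: index_mult_mat_vec intro: order_trans[OF norm_sum])
      also have "\<dots> \<le> (\<Sum>c<d. cmod (A $$ (r, c)))"
        using x_le by (intro sum_mono mult_right_le_one_le) auto
      finally show "cmod ((A *\<^sub>v x) $ r) \<le> (\<Sum>c<d. cmod (A $$ (r, c)))" .
    qed
    finally show ?thesis .
  qed
  then have "(SUP x\<in>sparse_ball d k. ennreal (vnorm (A *\<^sub>v x))) \<le> ennreal (\<Sum>r<m * B. \<Sum>c<d. cmod (A $$ (r, c)))"
    by (intro SUP_least ennreal_leI)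
  then show ?thesis
    using le_less_trans ennreal_less_top by blast
qed

text \<open>The first member of an admissible sequence has at most 4 points, so two of the 5 points
  \<open>j / 2 * t\<close> with \<open>\<bar>j\<bar> \<le> 2\<close> share a nearest point. This controls the diameter.\<close>

lemma block_norm_le_of_four_points:
  assumes m: "0 < m" and t: "t \<in> sparse_ball d k"
    and P: "finite P" "card P \<le> 4" "P \<subseteq> carrier_vec d"
    and near: "\<And>x. x \<in> sparse_ball d k \<Longrightarrow> \<exists>y\<in>P. block_norm m B A (y - x) \<le> g"
  shows "block_norm m B A t \<le> 4 * g"
proof -
  define s where "s j = complex_of_real (real_of_int j / 2) \<cdot>\<^sub>v t" for j :: int
  have t_carrier: "t \<in> carrier_vec d" using t by (simp add: sparse_ball_def)
  have s: "s j \<in> carrier_vec d" for j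
    using t_carrier by (simp add: s_def)
  have "\<exists>y\<in>P. block_norm m B A (y - s j) \<le> g" if "j \<in> {-2..2}" for j
    unfolding s_def using that by (intro near smult_in_sparse_ball t) (auto simp: norm_divide)
  then obtain f where f: "\<And>j. j \<in> {-2..2} \<Longrightarrow> f j \<in> P \<and> block_norm m B A (f j - s j) \<le> g"
    by metis
  have "\<not> inj_on f {-2..2}"
  proof
    assume "inj_on f {-2..2}"
    then have "card {-2..2::int} \<le> card P"
      using f P(1) by (intro card_inj_on_le[of f]) auto
    then show False using P(2) by simp
  qed
  then obtain i j where ij: "i \<in> {-2..2}" "j \<in> {-2..2}" "i \<noteq> j" "f i = f j"
    by (auto simp: inj_on_def)
  have fi: "f i \<in> carrier_vec d" using f[OF ij(1)] P(3) by auto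
  obtain b where b: "b < m" "block_norm m B A t = vnorm (row_block B A b *\<^sub>v t)"
    using block_norm_attained[OF m] by metis
  \<comment> \<open>Distinct half-integers differ by at least 1/2; against two errors of at most
    \<open>g\<close> this gives the factor 4.\<close>
  have "block_norm m B A t / 2 \<le> \<bar>real_of_int i / 2 - real_of_int j / 2\<bar> * block_norm m B A t"
  proof -
    have "1 \<le> \<bar>i - j\<bar>" using ij(3) by linarith
    then have "1 \<le> \<bar>real_of_int i - real_of_int j\<bar>" by linarith
    then have "1 / 2 \<le> \<bar>real_of_int i / 2 - real_of_int j / 2\<bar>" by linarith
    from mult_right_mono[OF this block_norm_nonneg[OF m]] show ?thesis by simp
  qed
  also have "\<dots> = vnorm (row_block B A b *\<^sub>v (s i - s j))"
  proof -
    have "block_entries B A (s i - s j) (b, l)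
        = complex_of_real (real_of_int i / 2 - real_of_int j / 2) * block_entries B A t (b, l)" if "l < B" for l
      using that b s t_carrier
      by (simp add: block_entries_diff) (simp add: s_def block_entries_smult left_diff_distrib)
    then have "vnorm (row_block B A b *\<^sub>v (s i - s j))
        = L2_set (\<lambda>l. \<bar>real_of_int i / 2 - real_of_int j / 2\<bar> * cmod (block_entries B A t (b, l))) {..<B}"
      unfolding vnorm_row_block[OF minus_carrier_vec[OF s s] b(1)]
      by (intro L2_set_cong) (auto simp: norm_mult simp del: of_real_diff of_real_divide)
    then show ?thesis
      using b t_carrier by (simp add: vnorm_row_block L2_set_right_distrib)
  qed
  also have "\<dots> \<le> block_norm m B A (s i - s j)"
    by (rule vnorm_row_block_le[OF b(1)])
  also have "\<dots> \<le> block_norm m B A (s i - f i) + block_norm m B A (f i - s j)"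
    by (intro block_norm_triangle m s fi)
  also have "\<dots> \<le> g + g"
    using f[OF ij(1)] f[OF ij(2)] ij(4) block_norm_commute[OF s fi] by (intro add_mono) auto
  finally show ?thesis by simp
qed

end

lemma avg_sup_chaos_le_of_gamma2_less:
  assumes A: "A \<in> carrier_mat (m * B) d" and m: "0 < m" and g: "0 < g" and F_nonneg: "0 \<le> F"
    and F: "\<And>x. x \<in> sparse_ball d k \<Longrightarrow> vnorm (A *\<^sub>v x) \<le> F"
    and less: "gamma2 (sparse_ball d k) (\<lambda>x y. block_norm m B A (x - y)) < ennreal g"
  shows "avg (signs ({..<m} \<times> {..<B})) (sup_chaos m B (block_entries B A) (sparse_ball d k))
    \<le> 8705 * (F * (6 * g) + (6 * g)\<^sup>2)"
proof -
  let ?T = "sparse_ball d k"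
  let ?\<rho> = "\<lambda>x y. block_norm m B A (x - y)"
  have T_carrier: "x \<in> carrier_vec d" if "x \<in> ?T" for x
    using that by (simp add: sparse_ball_def)
  have \<rho>_nonneg: "0 \<le> ?\<rho> x y" for x y
    by (rule block_norm_nonneg[OF A m])
  have T_nonempty: "?T \<noteq> {}"
    using zero_in_sparse_ball by blast
  obtain S \<pi> where S: "admissible_seq ?T S"
    and \<pi>: "\<And>n t. t \<in> ?T \<Longrightarrow> \<pi> n t \<in> S (Suc n)"
    and sum_le: "\<And>N t. t \<in> ?T \<Longrightarrow> (\<Sum>n<N. 2 powr (real (Suc n) / 2) * ?\<rho> (\<pi> n t) t) \<le> g"
    by (rule gamma2_lessE[OF less \<rho>_nonneg T_nonempty]) blast
  have S_props: "S (Suc n) \<subseteq> ?T" "finite (S (Suc n))" "card (S (Suc n)) \<le> 2 ^ (2 ^ Suc n)" for n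
    using S[unfolded admissible_seq_def, rule_format, of "Suc n"] by simp_all
  \<comment> \<open>Level 0, absent from \<open>gamma2\<close>, is filled with the zero vector,
    where the process vanishes.\<close>
  define S' where "S' n = (case n of 0 \<Rightarrow> {0\<^sub>v d} | Suc n' \<Rightarrow> S (Suc n'))" for n
  define \<pi>' where "\<pi>' n t = (case n of 0 \<Rightarrow> 0\<^sub>v d | Suc n' \<Rightarrow> \<pi> n' t)" for n t
  have S'_subset: "S' n \<subseteq> ?T" for n
    using S_props zero_in_sparse_ball by (auto simp: S'_def split: nat.split)
  have \<pi>': "\<pi>' n t \<in> S' n" if "t \<in> ?T" for n t
    using \<pi>[OF that] by (auto simp: S'_def \<pi>'_def split: nat.split)
  have \<pi>'_carrier: "\<pi>' n t \<in> carrier_vec d" if "t \<in> ?T" for n t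
    using \<pi>'[OF that] S'_subset T_carrier by blast
  have sum_le': "(\<Sum>n<N. 2 powr (real (Suc n) / 2) * ?\<rho> (\<pi>' (Suc n) t) t) \<le> g" if "t \<in> ?T" for N t
    using sum_le[OF that] by (simp add: \<pi>'_def)
  have norm_le: "block_norm m B A t \<le> 4 * g" if t: "t \<in> ?T" for t
  proof (rule block_norm_le_of_four_points[OF A m t, of "S (Suc 0)"])
    fix x assume x: "x \<in> ?T"
    have "2 powr (1 / 2) * ?\<rho> (\<pi> 0 x) x \<le> g"
      using sum_le[OF x, of 1] by simp
    moreover have "1 * ?\<rho> (\<pi> 0 x) x \<le> 2 powr (1 / 2) * ?\<rho> (\<pi> 0 x) x"
      by (intro mult_right_mono \<rho>_nonneg ge_one_powr_ge_zero) auto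
    ultimately have "?\<rho> (\<pi> 0 x) x \<le> g" by simp
    then show "\<exists>y\<in>S (Suc 0). ?\<rho> y x \<le> g"
      using \<pi>[OF x] by blast
  qed (use S_props[of 0] T_carrier in auto)
  interpret chaining m B ?T "block_entries B A" ?\<rho> "0\<^sub>v d" S' \<pi>' F "6 * g"
  proof
    show "(\<Sum>j\<in>{..<m} \<times> {..<B}. (cmod (block_entries B A x j))\<^sup>2) \<le> F\<^sup>2" if "x \<in> ?T" for x
      unfolding sum_block_entries[OF A] by (intro power_mono F that vnorm_nonneg)
    show "(\<Sum>i<B. (cmod (block_entries B A y (b, i) - block_entries B A x (b, i)))\<^sup>2) \<le> (?\<rho> x y)\<^sup>2"
      if "x \<in> ?T" "y \<in> ?T" "b < m" for x y b
      by (intro block_entries_lipschitz[OF A] T_carrier that)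
    show "block_entries B A (0\<^sub>v d) j = 0" if "j \<in> {..<m} \<times> {..<B}" for j
      using that by (auto simp: block_entries_eq[OF A])
    show "(\<Sum>n<N. 2 powr (real n / 2) * ?\<rho> (\<pi>' n t) (\<pi>' (Suc n) t)) \<le> 6 * g" if t: "t \<in> ?T" for t N
    proof -
      define q where "q n = 2 powr (real n / 2)" for n :: nat
      define a where "a n = ?\<rho> (\<pi>' n t) t" for n
      have q: "0 \<le> q n" "q n \<le> q (Suc n)" "q 0 = 1" for n
        by (simp_all add: q_def)
      have a_nonneg: "0 \<le> a n" for n
        by (simp add: a_def \<rho>_nonneg)
      have tail: "(\<Sum>n<N. q (Suc n) * a (Suc n)) \<le> g"
        using sum_le'[OF t] by (simp add: q_def a_def)
      have "a 0 = block_norm m B A t"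
      proof -
        have "a 0 = block_norm m B A (t - 0\<^sub>v d)"
          unfolding a_def \<pi>'_def using block_norm_commute[OF A _ T_carrier[OF t], of "0\<^sub>v d"] by simp
        then show ?thesis
          using T_carrier[OF t] by simp
      qed
      then have a_0: "a 0 \<le> 4 * g"
        using norm_le[OF t] by simp
      \<comment> \<open>Every link is routed through \<open>t\<close>. Its two ends contribute at
        most \<open>g\<close> each in total, apart from the initial \<open>a 0 \<le> 4 * g\<close>;
        hence \<open>6 * g\<close>.\<close>
      have "(\<Sum>n<N. q n * ?\<rho> (\<pi>' n t) (\<pi>' (Suc n) t)) \<le> (\<Sum>n<N. q n * (a n + a (Suc n)))"
      proof (intro sum_mono mult_left_mono q)
        fix n
        show "?\<rho> (\<pi>' n t) (\<pi>' (Suc n) t) \<le> a n + a (Suc n)"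
          unfolding a_def
          using block_norm_triangle[OF A m \<pi>'_carrier[OF t, of n] T_carrier[OF t] \<pi>'_carrier[OF t, of "Suc n"]]
            block_norm_commute[OF A T_carrier[OF t] \<pi>'_carrier[OF t, of "Suc n"]]
          by simp
      qed
      also have "\<dots> = (\<Sum>n<N. q n * a n) + (\<Sum>n<N. q n * a (Suc n))"
        by (simp add: distrib_left sum.distrib)
      also have "(\<Sum>n<N. q n * a n) \<le> (\<Sum>n<Suc N. q n * a n)"
        using q(1) a_nonneg by simp
      also have "\<dots> = a 0 + (\<Sum>n<N. q (Suc n) * a (Suc n))"
        by (subst sum.lessThan_Suc_shift) (simp add: q)
      also have "(\<Sum>n<N. q n * a (Suc n)) \<le> (\<Sum>n<N. q (Suc n) * a (Suc n))"
        by (intro sum_mono mult_right_mono q a_nonneg)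
      finally show ?thesis
        using a_0 tail by (simp add: q_def)
    qed
    show "(\<lambda>n. ?\<rho> (\<pi>' n t) t) \<longlonglongrightarrow> 0" if t: "t \<in> ?T" for t
    proof -
      \<comment> \<open>The weights are at least 1, so the distances themselves have bounded partial
        sums.\<close>
      have "summable (\<lambda>n. ?\<rho> (\<pi>' (Suc n) t) t)"
      proof (rule summableI_nonneg_bounded[OF \<rho>_nonneg])
        fix N
        have "(\<Sum>n<N. 1 * ?\<rho> (\<pi>' (Suc n) t) t) \<le> (\<Sum>n<N. 2 powr (real (Suc n) / 2) * ?\<rho> (\<pi>' (Suc n) t) t)"
          by (intro sum_mono mult_right_mono \<rho>_nonneg) (simp add: ge_one_powr_ge_zero)
        also have "\<dots> \<le> g"
          by (rule sum_le'[OF t])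
        finally show "(\<Sum>n<N. ?\<rho> (\<pi>' (Suc n) t) t) \<le> g" by simp
      qed
      then show ?thesis
        using summable_LIMSEQ_zero filterlim_sequentially_Suc by blast
    qed
  qed (use \<rho>_nonneg zero_in_sparse_ball S'_subset S_props \<pi>' F_nonneg g in \<open>auto simp: S'_def split: nat.split\<close>)
  show ?thesis
    by (rule avg_sup_chaos_le)
qed

subsection \<open>The expected isometry defect\<close>

lemma sign_pmf_eq: "sign_pmf m B = pmf_of_set (signs ({..<m} \<times> {..<B}))"
  unfolding sign_pmf_def signs_def by (rule Pi_pmf_of_set) auto

lemma nn_integral_sign_pmf:
  assumes "\<And>\<sigma>. \<sigma> \<in> signs ({..<m} \<times> {..<B}) \<Longrightarrow> 0 \<le> f \<sigma>"
  shows "(\<integral>\<^sup>+ \<sigma>. ennreal (f \<sigma>) \<partial>measure_pmf (sign_pmf m B)) = ennreal (avg (signs ({..<m} \<times> {..<B})) f)"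
proof -
  let ?S = "signs ({..<m} \<times> {..<B})"
  have S: "finite ?S" "?S \<noteq> {}"
    by (simp_all add: finite_signs signs_nonempty)
  have "(\<integral>\<^sup>+ \<sigma>. ennreal (f \<sigma>) \<partial>measure_pmf (sign_pmf m B)) = ennreal (\<Sum>\<sigma>\<in>?S. f \<sigma>) / of_nat (card ?S)"
    using S assms by (simp add: sign_pmf_eq nn_integral_pmf_of_set sum_ennreal)
  also have "\<dots> = ennreal ((\<Sum>\<sigma>\<in>?S. f \<sigma>) / real (card ?S))"
    using S assms by (simp add: ennreal_of_nat_eq_real_of_nat divide_ennreal sum_nonneg card_gt_0_iff)
  finally show ?thesis
    by (simp add: avg_def)
qed

text \<open>The constant is \<open>8705 * 36\<close>, with 36 from the square of
  \<open>6 * g\<close>. If \<open>gamma2\<close> is infinite, so is the right-hand side, its scalar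
  being positive.\<close>

lemma nn_integral_signed_isometry_defect_le:
  assumes A: "A \<in> carrier_mat (m * B) d" and m: "0 < m" and B: "0 < B"
  shows "(\<integral>\<^sup>+ \<sigma>. isometry_defect d k (m * B) (signed_block_sum m B A \<sigma>) \<partial>measure_pmf (sign_pmf m B))
    \<le> ennreal (313380 / real (m * B)) *
        ((SUP x\<in>sparse_ball d k. ennreal (vnorm (A *\<^sub>v x)))
            * gamma2 (sparse_ball d k) (\<lambda>x y. block_norm m B A (x - y))
          + (gamma2 (sparse_ball d k) (\<lambda>x y. block_norm m B A (x - y)))\<^sup>2)
      + isometry_defect d k (m * B) A"
    (is "_ \<le> ennreal ?c * (?F * ?\<gamma> + ?\<gamma>\<^sup>2) + _")
proof (cases "?\<gamma> = \<top>")
  case True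
  then show ?thesis
    using m B by (simp add: ennreal_mult_top power2_eq_square)
next
  case False
  let ?T = "sparse_ball d k"
  let ?J = "{..<m} \<times> {..<B}"
  let ?M = "sup_chaos m B (block_entries B A) ?T"
  define F where "F = enn2real ?F"
  have F: "?F = ennreal F" "0 \<le> F"
    unfolding F_def by (rule ennreal_enn2real[symmetric, OF SUP_vnorm_finite[OF A]]) (rule enn2real_nonneg)
  obtain \<gamma> where \<gamma>: "?\<gamma> = ennreal \<gamma>" "0 \<le> \<gamma>"
    using False by (cases ?\<gamma>) auto
  have F_le: "vnorm (A *\<^sub>v x) \<le> F" if "x \<in> ?T" for x
    using SUP_upper[OF that, of "\<lambda>x. ennreal (vnorm (A *\<^sub>v x))"] F by (simp add: ennreal_le_iff)
  have "avg (signs ?J) ?M \<le> 8705 * (F * (6 * g) + (6 * g)\<^sup>2)" if "\<gamma> < g" for g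
    using that \<gamma> F(2) F_le
    by (intro avg_sup_chaos_le_of_gamma2_less[OF A m]) (auto simp: ennreal_less_iff)
  \<comment> \<open>The chaining bound needs a \<open>g\<close> strictly above
    \<open>\<gamma>\<close>, hence positive even for \<open>\<gamma> = 0\<close>. A limit from the
    right reaches \<open>\<gamma>\<close> itself.\<close>
  then have "avg (signs ?J) ?M \<le> 8705 * (F * (6 * \<gamma>) + (6 * \<gamma>)\<^sup>2)"
    by (intro tendsto_lowerbound[where F="at_right \<gamma>" and f="\<lambda>g. 8705 * (F * (6 * g) + (6 * g)\<^sup>2)"])
       (auto intro!: tendsto_intros eventually_mono[OF eventually_at_right_less])
  also have "\<dots> \<le> 313380 * (F * \<gamma> + \<gamma>\<^sup>2)"
    using F(2) \<gamma>(2) by (simp add: power2_eq_square)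
  finally have avg_le: "avg (signs ?J) ?M \<le> 313380 * (F * \<gamma> + \<gamma>\<^sup>2)" .
  have chaos_le: "\<bar>chaos m B (block_entries B A x) \<sigma>\<bar> \<le> ?M \<sigma>" if "\<sigma> \<in> signs ?J" "x \<in> ?T" for \<sigma> x
    by (rule abs_chaos_le_sup_chaos[OF that, where R="F\<^sup>2"])
       (auto simp: sum_block_entries[OF A] intro!: power_mono F_le vnorm_nonneg)
  have M_nonneg: "0 \<le> ?M \<sigma>" if "\<sigma> \<in> signs ?J" for \<sigma>
    using chaos_le[OF that zero_in_sparse_ball] by (rule order_trans[OF abs_ge_zero])
  have defect_le: "isometry_defect d k (m * B) (signed_block_sum m B A \<sigma>)
      \<le> ennreal (1 / real (m * B) * ?M \<sigma>) + isometry_defect d k (m * B) A" if \<sigma>: "\<sigma> \<in> signs ?J" for \<sigma>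
    unfolding isometry_defect_def[of d k "m * B" "signed_block_sum m B A \<sigma>"]
  proof (rule SUP_least)
    fix x assume x: "x \<in> ?T"
    then have x_carrier: "x \<in> carrier_vec d" by (simp add: sparse_ball_def)
    let ?r = "1 / real (m * B)"
    have "\<bar>?r * (vnorm (signed_block_sum m B A \<sigma> *\<^sub>v x))\<^sup>2 - (vnorm x)\<^sup>2\<bar>
        = \<bar>?r * chaos m B (block_entries B A x) \<sigma> + (?r * (vnorm (A *\<^sub>v x))\<^sup>2 - (vnorm x)\<^sup>2)\<bar>"
      by (simp add: chaos_def vnorm_signed_block_sum[OF A x_carrier] sum_block_entries[OF A] right_diff_distrib diff_divide_distrib)
    also have "\<dots> \<le> ?r * ?M \<sigma> + \<bar>?r * (vnorm (A *\<^sub>v x))\<^sup>2 - (vnorm x)\<^sup>2\<bar>"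
      using chaos_le[OF \<sigma> x] by (intro order_trans[OF abs_triangle_ineq] add_right_mono) (simp add: abs_mult divide_right_mono)
    finally have "ennreal \<bar>?r * (vnorm (signed_block_sum m B A \<sigma> *\<^sub>v x))\<^sup>2 - (vnorm x)\<^sup>2\<bar>
        \<le> ennreal (?r * ?M \<sigma>) + ennreal \<bar>?r * (vnorm (A *\<^sub>v x))\<^sup>2 - (vnorm x)\<^sup>2\<bar>"
      using M_nonneg[OF \<sigma>]
      by (subst ennreal_plus[symmetric]) (auto intro!: ennreal_leI simp del: ennreal_plus)
    also have "\<dots> \<le> ennreal (?r * ?M \<sigma>) + isometry_defect d k (m * B) A"
      unfolding isometry_defect_def by (intro add_left_mono SUP_upper x)
    finally show "ennreal \<bar>?r * (vnorm (signed_block_sum m B A \<sigma> *\<^sub>v x))\<^sup>2 - (vnorm x)\<^sup>2\<bar>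
        \<le> ennreal (?r * ?M \<sigma>) + isometry_defect d k (m * B) A" .
  qed
  have set_pmf: "set_pmf (sign_pmf m B) = signs ?J"
    by (simp add: sign_pmf_eq finite_signs signs_nonempty)
  have "(\<integral>\<^sup>+ \<sigma>. isometry_defect d k (m * B) (signed_block_sum m B A \<sigma>) \<partial>measure_pmf (sign_pmf m B))
      \<le> (\<integral>\<^sup>+ \<sigma>. ennreal (1 / real (m * B) * ?M \<sigma>) + isometry_defect d k (m * B) A \<partial>measure_pmf (sign_pmf m B))"
    using defect_le by (intro nn_integral_mono_AE) (simp add: AE_measure_pmf_iff set_pmf)
  also have "\<dots> = (\<integral>\<^sup>+ \<sigma>. ennreal (1 / real (m * B) * ?M \<sigma>) \<partial>measure_pmf (sign_pmf m B)) + isometry_defect d k (m * B) A"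
    by (simp add: nn_integral_add)
  also have "(\<integral>\<^sup>+ \<sigma>. ennreal (1 / real (m * B) * ?M \<sigma>) \<partial>measure_pmf (sign_pmf m B))
      = ennreal (1 / real (m * B) * avg (signs ?J) ?M)"
    using M_nonneg by (subst nn_integral_sign_pmf) (auto simp only: avg_cmult intro!: mult_nonneg_nonneg divide_nonneg_nonneg of_nat_0_le_iff zero_le_one)
  also have "\<dots> \<le> ennreal (?c * (F * \<gamma> + \<gamma>\<^sup>2))"
    using mult_left_mono[OF avg_le, of "1 / real (m * B)"] by (intro ennreal_leI) simp
  also have "\<dots> = ennreal ?c * (?F * ?\<gamma> + ?\<gamma>\<^sup>2)"
  proof -
    have "0 \<le> F * \<gamma> + \<gamma>\<^sup>2" "0 \<le> F * \<gamma>" "0 \<le> \<gamma>\<^sup>2" "0 \<le> ?c"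
      using F(2) \<gamma>(2) by auto
    then show ?thesis
      using F \<gamma> by (simp only: ennreal_mult ennreal_plus ennreal_power)
  qed
  finally show ?thesis
    by (simp add: add_right_mono)
qed

lemma expected_signed_isometry_defect_le:
  fixes K L :: real
  assumes m: "0 < m" and B: "0 < B" and L: "0 < L" and \<A>: "mat_distribution (m * B) d \<A>"
    and defect: "(\<integral>\<^sup>+ A. isometry_defect d k (m * B) A \<partial>\<A>) \<le> ennreal (K * sqrt (L / real (m * B)))"
  shows "(\<integral>\<^sup>+ (A, \<sigma>). isometry_defect d k (m * B) (signed_block_sum m B A \<sigma>)
        \<partial>(\<A> \<Otimes>\<^sub>M measure_pmf (sign_pmf m B)))
      \<le> ennreal (626760 + \<bar>K\<bar>) *
         (ennreal (1 / real (m * B)) *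
            ((\<integral>\<^sup>+ A. (SUP x\<in>sparse_ball d k. ennreal (vnorm (A *\<^sub>v x)))
                 * gamma2 (sparse_ball d k) (\<lambda>x y. block_norm m B A (x - y)) \<partial>\<A>)
             + (\<integral>\<^sup>+ A. (gamma2 (sparse_ball d k) (\<lambda>x y. block_norm m B A (x - y)))\<^sup>2 \<partial>\<A>))
          + ennreal (sqrt (L / real (m * B))))"
proof -
  \<comment> \<open>Twice 313380, the 2 being the price of splitting the lower integral. The
    absolute value covers a negative \<open>K\<close>, for which \<open>ennreal\<close> truncates
    the assumed bound to 0.\<close>
  let ?C = "626760 + \<bar>K\<bar>"
  let ?P = "measure_pmf (sign_pmf m B)" and ?c = "313380 / real (m * B)"
  let ?F = "\<lambda>A. SUP x\<in>sparse_ball d k. ennreal (vnorm (A *\<^sub>v x))"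
  let ?\<gamma> = "\<lambda>A. gamma2 (sparse_ball d k) (\<lambda>x y. block_norm m B A (x - y))"
  let ?I = "(\<integral>\<^sup>+ A. ?F A * ?\<gamma> A \<partial>\<A>) + (\<integral>\<^sup>+ A. (?\<gamma> A)\<^sup>2 \<partial>\<A>)"
  have P: "sigma_finite_measure ?P"
    by (rule prob_space_imp_sigma_finite) (rule prob_space_measure_pmf)
  have "(\<integral>\<^sup>+ (A, \<sigma>). isometry_defect d k (m * B) (signed_block_sum m B A \<sigma>) \<partial>(\<A> \<Otimes>\<^sub>M ?P))
      \<le> (\<integral>\<^sup>+ A. (\<integral>\<^sup>+ \<sigma>. isometry_defect d k (m * B) (signed_block_sum m B A \<sigma>) \<partial>?P) \<partial>\<A>)"
    using sigma_finite_measure.nn_integral_pair_le[OF P, where N = \<A>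
        and f = "\<lambda>(A, \<sigma>). isometry_defect d k (m * B) (signed_block_sum m B A \<sigma>)"] by simp
  also have "\<dots> \<le> ennreal (2 * ?c) * ?I + (\<integral>\<^sup>+ A. isometry_defect d k (m * B) A \<partial>\<A>)"
    using m B space_mat_distribution[OF \<A>]
    by (intro nn_integral_quadratic_le borel_measurable_SUP_vnorm[OF \<A>] borel_measurable_isometry_defect[OF \<A>]
        nn_integral_signed_isometry_defect_le) auto
  also have "\<dots> \<le> ennreal ?C * (ennreal (1 / real (m * B)) * ?I) + ennreal ?C * ennreal (sqrt (L / real (m * B)))"
  proof (rule add_mono)
    have "ennreal (2 * ?c) = ennreal 626760 * ennreal (1 / real (m * B))"
      by (subst ennreal_mult[symmetric]) auto
    then have "ennreal (2 * ?c) * ?I = ennreal 626760 * (ennreal (1 / real (m * B)) * ?I)"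
      by (simp only: mult.assoc)
    also have "\<dots> \<le> ennreal ?C * (ennreal (1 / real (m * B)) * ?I)"
      by (intro mult_right_mono ennreal_leI) auto
    finally show "ennreal (2 * ?c) * ?I \<le> ennreal ?C * (ennreal (1 / real (m * B)) * ?I)" .
    have "K * sqrt (L / real (m * B)) \<le> ?C * sqrt (L / real (m * B))"
      using L by (intro mult_right_mono) auto
    then have "ennreal (K * sqrt (L / real (m * B))) \<le> ennreal ?C * ennreal (sqrt (L / real (m * B)))"
      using L by (subst ennreal_mult[symmetric]) (auto intro: ennreal_leI)
    with defect show "(\<integral>\<^sup>+ A. isometry_defect d k (m * B) A \<partial>\<A>) \<le> ennreal ?C * ennreal (sqrt (L / real (m * B)))"
      by (rule order_trans)
  qed
  finally show "(\<integral>\<^sup>+ (A, \<sigma>). isometry_defect d k (m * B) (signed_block_sum m B A \<sigma>) \<partial>(\<A> \<Otimes>\<^sub>M ?P))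
      \<le> ennreal ?C * (ennreal (1 / real (m * B)) * ?I + ennreal (sqrt (L / real (m * B))))"
    by (simp only: distrib_left)
qed

text \<open>\<open>K\<close> is the implied constant of the hypothesis. It is quantified before
  \<open>C\<close>, which may thus depend on it, but on neither \<open>L\<close>, the dimensions nor
  the distribution.\<close>

theorem theorem5:
  shows "\<forall>K::real. \<exists>C>0. \<forall>(d::nat) (k::nat) (m::nat) (B::nat) (L::real) (\<A>::complex mat measure).
    d > 0 \<longrightarrow> k > 0 \<longrightarrow> m > 0 \<longrightarrow> B > 0 \<longrightarrow> L > 0 \<longrightarrow>
    mat_distribution (m * B) d \<A> \<longrightarrow>
    (\<integral>\<^sup>+ A. isometry_defect d k (m * B) A \<partial>\<A>) \<le> ennreal (K * sqrt (L / real (m * B))) \<longrightarrow>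
    (\<integral>\<^sup>+ (A, \<sigma>). isometry_defect d k (m * B) (signed_block_sum m B A \<sigma>)
        \<partial>(\<A> \<Otimes>\<^sub>M measure_pmf (sign_pmf m B)))
      \<le> ennreal C *
         (ennreal (1 / real (m * B)) *
            ((\<integral>\<^sup>+ A. (SUP x\<in>sparse_ball d k. ennreal (vnorm (A *\<^sub>v x)))
                 * gamma2 (sparse_ball d k) (\<lambda>x y. block_norm m B A (x - y)) \<partial>\<A>)
             + (\<integral>\<^sup>+ A. (gamma2 (sparse_ball d k) (\<lambda>x y. block_norm m B A (x - y)))\<^sup>2 \<partial>\<A>))
          + ennreal (sqrt (L / real (m * B))))"
  by (intro allI exI[where x = "626760 + \<bar>K\<bar>" for K] conjI impI expected_signed_isometry_defect_le)
     (auto intro: add_pos_nonneg)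

end
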